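(* Let $\mathbb{K}$ be a field and let $\mathcal{C}$ be a binary $[n,k]$ code with generator matrix $G\in\mathbb{F}_2^{k\times n}$ and code ideal $I_{\mathcal{C}}\subseteq\mathbb{K}[x_1,\dots,x_n]$. Then the universal Gröbner basis of $I_{\mathcal{C}}$ is $$\mathcal{U}_{\mathcal{C}}=\Big\{\mathbf{x}^{c}-\mathbf{x}^{c'}\ \Big|\ c-c'\in\mathcal{C},\ \mathrm{wt}(c-c')\le n-k+1,\ \mathrm{rk}\big(G_{\underline{n}\setminus\mathrm{supp}(c-c')}\big)=k-1\Big\}\cup\big\{x_i^2-1\mid 1\le i\le n\big\},$$ where $c,c'$ range over the non-zero vectors in $\mathbb{F}_2^n$ with $\mathrm{supp}(c)\cap\mathrm{supp}(c')=\emptyset$.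
   Context: **Codes.** A binary $[n,k]$ code (with $n\ge k$ positive integers) is a $k$-dimensional linear subspace of $\mathbb{F}_2^n$. A generator matrix is a $k\times n$ matrix whose rows form a basis of the code. All codes are assumed to have no zero column in their generator matrices. Put $\underline{n}=\{1,\dots,n\}$. For $u\in\mathbb{F}_2^n$, $\mathrm{supp}(u)=\{i\in\underline{n}\mid u_i\ne 0\}$ and $\mathrm{wt}(u)=|\mathrm{supp}(u)|$. For $J\subseteq\underline{n}$, $G_J$ is the $k\times|J|$ submatrix of $G$ consisting of the columns with indices in $J$ (of rank $0$ if $J=\emptyset$), and $\mathrm{rk}$ denotes the rank over $\mathbb{F}_2$. **Code ideal.** Write $\mathbf{x}^u=x_1^{u_1}\cdots x_n^{u_n}$, where a vector $u\in\mathbb{F}_2^n$ is used as an exponent by taking the representatives of its entries in $\{0,1\}$. The code ideal of $\mathcal{C}$ in $\mathbb{K}[x_1,\dots,x_n]$ is $$I_{\mathcal{C}}=\langle \mathbf{x}^c-\mathbf{x}^{c'}\mid c-c'\in\mathcal{C}\rangle+\langle x_i^2-1\mid 1\le i\le n\rangle .$$ **Universal Gröbner basis.** $\mathcal{U}_{\mathcal{C}}$ is the union of all reduced Gröbner bases of $I_{\mathcal{C}}$, taken over all monomial orders on $\mathbb{K}[x_1,\dots,x_n]$. Elements of reduced Gröbner bases have leading coefficient $1$.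
   Formalization: Adds the hypothesis that the code has no codeword of weight 1; if a unit vector e_i lies in the code, then x_i − 1 is in the ideal, x_i² − 1 lies in no reduced Gröbner basis, and the stated equality fails (e.g. n = k = 1). *)

theory Defs
  imports "HOL-Analysis.Analysis" "HOL-Library.Poly_Mapping" "HOL-Library.Z2"
begin

section \<open>Polynomials, ideals and Groebner bases\<close>

text \<open>
  Variables are indexed by a finite type \<^typ>\<open>'n\<close>, so the number of variables is CARD('n).
  A monomial is identified with its exponent vector; monomials are multiplied by adding
  exponent vectors, and the product of polynomials is the convolution product of
  \<^theory>\<open>HOL-Library.Poly_Mapping\<close>.
\<close>

type_synonym 'n mon = "'n \<Rightarrow>\<^sub>0 nat"
type_synonym ('n, 'a) mpoly = "'n mon \<Rightarrow>\<^sub>0 'a"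

definition mono_poly :: "'n mon \<Rightarrow> ('n, 'a::comm_ring_1) mpoly" where
  "mono_poly t = Poly_Mapping.single t 1"

definition var :: "'n \<Rightarrow> ('n, 'a::comm_ring_1) mpoly" where
  "var i = mono_poly (Poly_Mapping.single i 1)"

definition mon_dvd :: "'n mon \<Rightarrow> 'n mon \<Rightarrow> bool" where
  "mon_dvd s t \<longleftrightarrow> (\<exists>u. t = s + u)"

definition ideal_gen :: "'b::comm_ring_1 set \<Rightarrow> 'b set" where
  "ideal_gen S = module.span (*) S"

lemma module_self: "module ((*) :: 'b::comm_ring_1 \<Rightarrow> 'b \<Rightarrow> 'b)"
  by unfold_locales (auto simp: algebra_simps)

definition ideal_sum :: "'b::comm_ring_1 set \<Rightarrow> 'b set \<Rightarrow> 'b set" where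
  "ideal_sum I J = {f + g | f g. f \<in> I \<and> g \<in> J}"

text \<open>
  A pair \<open>(s, t)\<close> in the relation means that \<open>s\<close> is at most \<open>t\<close>. Since there are
  finitely many variables, these three conditions imply that the order is a well-order.
\<close>

definition monomial_order :: "('n mon \<times> 'n mon) set \<Rightarrow> bool" where
  "monomial_order r \<longleftrightarrow> linear_order r \<and> (\<forall>t. (0, t) \<in> r) \<and>
     (\<forall>s t u. (s, t) \<in> r \<longrightarrow> (s + u, t + u) \<in> r)"

text \<open>Only meaningful for a non-zero polynomial.\<close>

definition lead_mon :: "('n mon \<times> 'n mon) set \<Rightarrow> ('n, 'a::field) mpoly \<Rightarrow> 'n mon" where
  "lead_mon r p = (THE t. t \<in> Poly_Mapping.keys p \<and> (\<forall>s \<in> Poly_Mapping.keys p. (s, t) \<in> r))"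

definition lead_coeff :: "('n mon \<times> 'n mon) set \<Rightarrow> ('n, 'a::field) mpoly \<Rightarrow> 'a" where
  "lead_coeff r p = Poly_Mapping.lookup p (lead_mon r p)"

text \<open>Over a field, leading monomials and leading terms generate the same ideal.\<close>

definition lead_ideal :: "('n mon \<times> 'n mon) set \<Rightarrow> ('n, 'a::field) mpoly set \<Rightarrow> ('n, 'a) mpoly set" where
  "lead_ideal r F = ideal_gen {mono_poly (lead_mon r f) | f. f \<in> F \<and> f \<noteq> 0}"

definition groebner_basis ::
  "('n mon \<times> 'n mon) set \<Rightarrow> ('n, 'a::field) mpoly set \<Rightarrow> ('n, 'a) mpoly set \<Rightarrow> bool" where
  "groebner_basis r I B \<longleftrightarrow> finite B \<and> B \<subseteq> I \<and> lead_ideal r B = lead_ideal r I"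

text \<open>The condition on leading coefficients excludes the zero polynomial.\<close>

definition reduced_groebner_basis ::
  "('n mon \<times> 'n mon) set \<Rightarrow> ('n, 'a::field) mpoly set \<Rightarrow> ('n, 'a) mpoly set \<Rightarrow> bool" where
  "reduced_groebner_basis r I B \<longleftrightarrow> groebner_basis r I B \<and>
     (\<forall>g \<in> B. lead_coeff r g = 1) \<and>
     (\<forall>g \<in> B. \<forall>h \<in> B. g \<noteq> h \<longrightarrow>
        (\<forall>t \<in> Poly_Mapping.keys h. \<not> mon_dvd (lead_mon r g) t))"

definition universal_groebner_basis :: "('n, 'a::field) mpoly set \<Rightarrow> ('n, 'a) mpoly set" where
  "universal_groebner_basis I =
     \<Union> {B. \<exists>r. monomial_order r \<and> reduced_groebner_basis r I B}"


section \<open>Binary codes and their ideals\<close>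

text \<open>
  The ambient space of binary words of length CARD('n) is \<^typ>\<open>bit^'n\<close>, where
  \<^typ>\<open>bit\<close> is the field with two elements.
\<close>

definition supp :: "bit^'n \<Rightarrow> 'n set" where
  "supp u = {i. u $ i \<noteq> 0}"

definition wt :: "bit^'n \<Rightarrow> nat" where
  "wt u = card (supp u)"

definition binary_code :: "nat \<Rightarrow> (bit^'n) set \<Rightarrow> bool" where
  "binary_code k C \<longleftrightarrow> vec.subspace C \<and> vec.dim C = k"

text \<open>\<^term>\<open>rows G\<close> is a set, so injectivity is needed to say that the family of rows is a basis.\<close>

definition generator_matrix :: "bit^'n^'k \<Rightarrow> (bit^'n) set \<Rightarrow> bool" where
  "generator_matrix G C \<longleftrightarrow>
     inj (\<lambda>i. row i G) \<and> vec.independent (rows G) \<and> vec.span (rows G) = C"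

text \<open>
  The submatrix on the columns in \<open>J\<close>. As the number of columns is part of the type, the
  other columns are replaced by zero columns instead of being deleted, which does not affect
  the rank.
\<close>

definition col_submatrix :: "bit^'n^'k \<Rightarrow> 'n set \<Rightarrow> bit^'n^'k" where
  "col_submatrix G J = (\<chi> i j. if j \<in> J then G $ i $ j else 0)"

definition bit_exp :: "bit^'n \<Rightarrow> 'n mon" where
  "bit_exp u = Abs_poly_mapping (\<lambda>i. if u $ i = 0 then 0 else 1)"

definition xpow :: "bit^'n \<Rightarrow> ('n, 'a::field) mpoly" where
  "xpow u = mono_poly (bit_exp u)"

definition code_ideal :: "(bit^'n) set \<Rightarrow> ('n, 'a::field) mpoly set" where
  "code_ideal C = ideal_sum
     (ideal_gen {xpow c - xpow c' | c c'. c - c' \<in> C})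
     (ideal_gen {var i ^ 2 - 1 | i. True})"


section \<open>Codewords of weight one\<close>

text \<open>
  If a code contains a unit vector, then \<^term>\<open>var i - 1\<close> lies in its ideal, and therefore
  \<^term>\<open>var i ^ 2 - 1\<close> belongs to no reduced Groebner basis at all.
  For such codes the universal Groebner basis therefore does not contain all the binomials
  \<^term>\<open>var i ^ 2 - 1\<close>, which is why they have to be excluded.
\<close>

lemma lookup_bit_exp [simp]:
  "Poly_Mapping.lookup (bit_exp (u :: bit^'n)) i = (if u $ i = 0 then 0 else 1)"
  unfolding bit_exp_def by (simp add: Abs_poly_mapping_inverse)

lemma mono_in_ideal_gen_dvd:
  assumes "mono_poly t \<in> ideal_gen (mono_poly ` S :: ('n, 'a::field) mpoly set)"
  shows "\<exists>s \<in> S. mon_dvd s t"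
proof -
  interpret module "(*) :: ('n, 'a) mpoly \<Rightarrow> _" by (rule module_self)
  define P where "P p \<longleftrightarrow> (\<forall>t \<in> Poly_Mapping.keys p. \<exists>s \<in> S. mon_dvd s t)"
    for p :: "('n, 'a) mpoly"
  have "P p" if "p \<in> span (mono_poly ` S)" for p
    using that
  proof (induction rule: span_induct_alt)
    case base
    show ?case by (simp add: P_def)
  next
    case (step c x y)
    then obtain s where s: "s \<in> S" "x = mono_poly s" by blast
    have "Poly_Mapping.keys (c * x) \<subseteq> {a + b | a b. a \<in> Poly_Mapping.keys c \<and> b \<in> Poly_Mapping.keys x}"
      using keys_mult by blast
    also have "\<dots> \<subseteq> {t. mon_dvd s t}"
      by (auto simp: s mono_poly_def mon_dvd_def intro: add.commute)
    finally have "Poly_Mapping.keys (c * x) \<subseteq> {t. mon_dvd s t}" .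
    moreover have "Poly_Mapping.keys (c * x + y) \<subseteq> Poly_Mapping.keys (c * x) \<union> Poly_Mapping.keys y"
      by (rule Poly_Mapping.keys_add)
    ultimately show ?case
      using step s(1) unfolding P_def by blast
  qed
  then show ?thesis
    using assms by (auto simp: ideal_gen_def P_def mono_poly_def)
qed

lemma square_notin_universal_groebner_basis:
  fixes C :: "(bit^'n) set"
  assumes "axis i 1 \<in> C"
  shows "var i ^ 2 - 1 \<notin> universal_groebner_basis (code_ideal C :: ('n, 'a::field) mpoly set)"
proof
  let ?I = "code_ideal C :: ('n, 'a) mpoly set"
  let ?e = "Poly_Mapping.single i 1 :: 'n mon"
  let ?q = "var i ^ 2 - 1 :: ('n, 'a) mpoly"
  let ?p = "var i - 1 :: ('n, 'a) mpoly"
  interpret module "(*) :: ('n, 'a) mpoly \<Rightarrow> _" by (rule module_self)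
  assume "?q \<in> universal_groebner_basis ?I"
  then obtain B r where r: "monomial_order r" and B: "reduced_groebner_basis r ?I B" and qB: "?q \<in> B"
    by (auto simp: universal_groebner_basis_def)
  have "bit_exp (axis i 1 :: bit^'n) = ?e"
    by (rule poly_mapping_eqI) (auto simp: axis_def lookup_single when_def)
  moreover have "bit_exp (0 :: bit^'n) = 0"
    by (rule poly_mapping_eqI) auto
  ultimately have p: "?p = xpow (axis i 1 :: bit^'n) - xpow (0 :: bit^'n)"
    by (simp add: xpow_def var_def mono_poly_def)
  have "?p \<in> ideal_gen {xpow c - xpow c' | c c'. c - c' \<in> C}"
    unfolding ideal_gen_def p
  proof (rule span_base, intro CollectI exI conjI)
    show "axis i 1 - 0 \<in> C" using assms by simp
  qed (rule refl)
  then have pI: "?p \<in> ?I"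
    unfolding code_ideal_def ideal_sum_def ideal_gen_def using span_zero by force
  have e0: "?e \<noteq> 0"
    by (metis lookup_single_eq lookup_zero zero_neq_one)
  have q: "?q = mono_poly (?e + ?e) - mono_poly 0"
    by (simp add: var_def mono_poly_def power2_eq_square mult_single)
  have ee: "?e + ?e \<noteq> 0" "?e + ?e \<noteq> ?e"
    using e0 by (auto dest!: arg_cong[where f = "\<lambda>t. Poly_Mapping.lookup t i"] simp: lookup_add)
  have keys: "Poly_Mapping.keys (mono_poly t - mono_poly 0 :: ('n, 'a) mpoly) = {t, 0}" if "t \<noteq> 0" for t
    using that by (auto simp: mono_poly_def in_keys_iff lookup_minus lookup_single lookup_one when_def split: if_splits)
  have refl: "(t, t) \<in> r" and zero: "(0, t) \<in> r" for t
    using r by (auto simp: monomial_order_def linear_order_on_def partial_order_on_def preorder_on_def refl_on_def)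
  have "antisym r"
    using r by (auto simp: monomial_order_def linear_order_on_def partial_order_on_def)
  then have lead: "lead_mon r (mono_poly t - mono_poly 0 :: ('n, 'a) mpoly) = t" if "t \<noteq> 0" for t
    unfolding lead_mon_def keys[OF that]
    by (intro the_equality) (auto simp: refl zero dest: antisymD)
  have p': "?p = mono_poly ?e - mono_poly 0"
    by (simp add: var_def mono_poly_def)
  have p0: "?p \<noteq> 0"
    unfolding p' using keys[OF e0] by (metis insert_not_empty keys_zero)
  have "mono_poly ?e \<in> lead_ideal r ?I"
    unfolding lead_ideal_def ideal_gen_def
    by (rule span_base) (use pI p0 lead[OF e0] p' in force)
  also have "lead_ideal r ?I = ideal_gen (mono_poly ` (lead_mon r ` {f \<in> B. f \<noteq> 0}))"
    using B unfolding reduced_groebner_basis_def groebner_basis_def lead_ideal_def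
    by (simp add: image_image setcompr_eq_image)
  finally obtain g where g: "g \<in> B" "mon_dvd (lead_mon r g) ?e"
    using mono_in_ideal_gen_dvd by blast
  have "mon_dvd (lead_mon r g) (?e + ?e)"
    using g(2) unfolding mon_dvd_def by (metis add.assoc)
  moreover have "?e + ?e \<in> Poly_Mapping.keys ?q"
    unfolding q keys[OF ee(1)] by simp
  ultimately have "g = ?q"
    using B g(1) qB unfolding reduced_groebner_basis_def by blast
  then have "lead_mon r g = ?e + ?e"
    using lead[OF ee(1)] q by simp
  with g(2) obtain u where "?e = ?e + ?e + u" by (auto simp: mon_dvd_def)
  then have "Poly_Mapping.lookup ?e i = Poly_Mapping.lookup (?e + ?e + u) i" by simp
  then show False by (simp add: lookup_add)
qed

end

theory Submission
  imports Defs
begin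

text \<open>
  Call two monomials equivalent if their exponent vectors modulo 2 differ by a codeword. A
  polynomial lies in the code ideal only if its coefficients sum to zero over each class. Hence, for a
  monomial order, the leading monomials of the ideal are the monomials that are not least in their class,
  and the reduced Groebner basis consists of the binomials \<open>t - s\<close> where \<open>t\<close> is
  minimal with respect to divisibility among these and \<open>s\<close> is the least monomial
  equivalent to \<open>t\<close>. Unless \<open>t = x_i^2\<close> (then \<open>s = 1\<close>), one has \<open>t = x^c\<close> and
  \<open>s = x^c'\<close> with \<open>c - c'\<close> a codeword of minimal support: a
  smaller codeword supported in \<open>c - c'\<close> would make a proper divisor of \<open>t\<close>, or a
  divisor of \<open>s\<close>, equivalent to a smaller monomial. Conversely, a suitable weighted order realises
  every splitting of a minimal codeword. By rank-nullity, the rank condition says exactly that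
  \<open>c - c'\<close> is minimal.
\<close>

section \<open>Monomials\<close>

abbreviation expo :: "'n mon \<Rightarrow> 'n \<Rightarrow> nat" where
  "expo \<equiv> Poly_Mapping.lookup"

text \<open>The class of a monomial modulo the squares: multiplying by \<open>x_i^2\<close> does not
  change it.\<close>

definition parity :: "('n::finite) mon \<Rightarrow> bit^'n" where
  "parity t = (\<chi> i. of_nat (expo t i))"

lemma supp_inject [simp]: "supp u = supp v \<longleftrightarrow> u = v"
proof
  assume *: "supp u = supp v"
  have "u $ i = v $ i" for i
  proof -
    have "u $ i = 1 \<longleftrightarrow> v $ i = 1"
      using * by (simp add: supp_def set_eq_iff)
    then show ?thesis
      by (cases "u $ i"; cases "v $ i") simp_all
  qed
  then show "u = v"
    by (simp add: vec_eq_iff)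
qed simp

lemma finite_bit_vec: "finite (UNIV :: (bit^'n) set)"
  by (rule finite_imageD[of supp]) (auto intro: injI)

lemma supp_eq_empty_iff [simp]: "supp u = {} \<longleftrightarrow> u = 0"
  by (auto simp: supp_def vec_eq_iff)

lemma supp_zero [simp]: "supp 0 = {}"
  by simp

lemma supp_axis: "supp (axis i 1) = {i}"
  by (auto simp: supp_def axis_def)

lemma bit_vec_diff: "u - v = u + (v :: bit^'n)"
  by (simp add: vec_eq_iff)

lemma bit_vec_add_self [simp]: "u + u = (0 :: bit^'n)"
  by (metis bit_vec_diff right_minus_eq)

lemma supp_add: "supp (u + v) = (supp u \<union> supp v) - (supp u \<inter> supp v)"
proof (rule set_eqI)
  fix i
  show "i \<in> supp (u + v) \<longleftrightarrow> i \<in> (supp u \<union> supp v) - (supp u \<inter> supp v)"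
    by (cases "u $ i"; cases "v $ i") (simp_all add: supp_def)
qed

lemma parity_zero [simp]: "parity 0 = 0"
  by (simp add: parity_def vec_eq_iff)

lemma parity_add [simp]: "parity (s + t) = parity s + parity t"
  by (simp add: parity_def vec_eq_iff lookup_add)

lemma parity_bit_exp [simp]: "parity (bit_exp u) = u"
  by (simp add: parity_def vec_eq_iff)

lemma bit_exp_zero [simp]: "bit_exp (0 :: bit^'n) = 0"
  by (rule poly_mapping_eqI) auto

lemma bit_exp_inject [simp]: "bit_exp u = bit_exp v \<longleftrightarrow> u = v"
  by (metis parity_bit_exp)

lemma bit_exp_eq_0_iff [simp]: "bit_exp u = 0 \<longleftrightarrow> u = 0"
  by (metis bit_exp_inject bit_exp_zero)

lemma bit_exp_axis: "bit_exp (axis i 1 :: bit^'n) = Poly_Mapping.single i 1"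
  by (rule poly_mapping_eqI) (auto simp: axis_def lookup_single when_def)

lemma bit_exp_parity:
  assumes "\<And>i. expo t i \<le> 1"
  shows "bit_exp (parity t) = t"
proof (rule poly_mapping_eqI)
  fix i
  have "expo t i = 0 \<or> expo t i = 1"
    using assms[of i] by linarith
  then show "expo (bit_exp (parity t)) i = expo t i"
    by (auto simp: parity_def)
qed

lemma bit_exp_add:
  assumes "supp u \<inter> supp v = {}"
  shows "bit_exp (u + v) = bit_exp u + bit_exp v"
proof (rule poly_mapping_eqI)
  fix i
  have "u $ i = 0 \<or> v $ i = 0"
    using assms by (auto simp: supp_def)
  then show "expo (bit_exp (u + v)) i = expo (bit_exp u + bit_exp v) i"
    by (auto simp: lookup_add)
qed

section \<open>Divisibility of monomials\<close>

lemma mon_dvd_iff: "mon_dvd s t \<longleftrightarrow> (\<forall>i. expo s i \<le> expo t i)"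
proof
  assume "\<forall>i. expo s i \<le> expo t i"
  then have "t = s + (t - s)"
    by (intro poly_mapping_eqI) (simp add: lookup_add lookup_minus)
  then show "mon_dvd s t"
    unfolding mon_dvd_def by blast
qed (auto simp: mon_dvd_def lookup_add)

lemma mon_dvd_refl [simp]: "mon_dvd t t"
  by (simp add: mon_dvd_iff)

lemma mon_dvd_trans: "mon_dvd s t \<Longrightarrow> mon_dvd t u \<Longrightarrow> mon_dvd s u"
  by (meson mon_dvd_iff order_trans)

lemma mon_dvd_antisym: "mon_dvd s t \<Longrightarrow> mon_dvd t s \<Longrightarrow> s = t"
  by (intro poly_mapping_eqI) (meson mon_dvd_iff order_antisym)

lemma mon_dvd_bit_exp_iff: "mon_dvd (bit_exp u) (bit_exp v) \<longleftrightarrow> supp u \<subseteq> supp v"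
  by (auto simp: mon_dvd_iff supp_def subset_iff)

lemma bit_exp_parity_dvd: "mon_dvd (bit_exp (parity t)) t"
  unfolding mon_dvd_iff
proof
  fix i
  show "expo (bit_exp (parity t)) i \<le> expo t i"
    by (cases "expo t i = 0") (simp_all add: parity_def)
qed

lemma single_dvd_iff: "mon_dvd (Poly_Mapping.single i k) t \<longleftrightarrow> k \<le> expo t i"
  by (simp add: mon_dvd_iff lookup_single when_def)

section \<open>Weighted degrees\<close>

definition wdeg :: "('n::finite \<Rightarrow> nat) \<Rightarrow> 'n mon \<Rightarrow> nat" where
  "wdeg w t = (\<Sum>i\<in>UNIV. w i * expo t i)"

abbreviation mon_deg :: "('n::finite) mon \<Rightarrow> nat" where
  "mon_deg \<equiv> wdeg (\<lambda>_. 1)"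

lemma wdeg_add: "wdeg w (s + t) = wdeg w s + wdeg w t"
  by (simp add: wdeg_def lookup_add sum.distrib distrib_left)

lemma wdeg_zero [simp]: "wdeg w 0 = 0"
  by (simp add: wdeg_def)

lemma wdeg_mono: "mon_dvd s t \<Longrightarrow> wdeg w s \<le> wdeg w t"
  by (auto simp: mon_dvd_def wdeg_add)

lemma wdeg_ge: "w i * expo t i \<le> wdeg w t"
  unfolding wdeg_def by (rule member_le_sum) auto

lemma wdeg_bit_exp: "wdeg w (bit_exp u) = sum w (supp u)"
  unfolding wdeg_def supp_def by (simp add: if_distrib[of "(*) _"] sum.If_cases Compl_eq)

lemma mon_deg_eq_0_iff: "mon_deg t = 0 \<longleftrightarrow> t = 0"
  by (simp add: wdeg_def poly_mapping_eq_iff fun_eq_iff)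

lemma mono_poly_add: "mono_poly (s + t) = mono_poly s * mono_poly t"
  by (simp add: mono_poly_def mult_single)

lemma lookup_mono_poly: "Poly_Mapping.lookup (mono_poly t) s = (if s = t then 1 else 0)"
  by (auto simp: mono_poly_def lookup_single when_def)

lemma keys_binomial:
  "s \<noteq> t \<Longrightarrow> Poly_Mapping.keys (mono_poly t - mono_poly s :: ('n, 'a::field) mpoly) = {t, s}"
  by (auto simp: in_keys_iff lookup_minus lookup_mono_poly split: if_splits)

section \<open>The code ideal\<close>

definition code_equiv :: "(bit^'n) set \<Rightarrow> 'n mon \<Rightarrow> 'n mon \<Rightarrow> bool" where
  "code_equiv C s t \<longleftrightarrow> parity s - parity t \<in> C"

text \<open>A linear functional attached to the coset of \<open>v\<close>. The vanishing of these
  functionals on the code ideal is the only obstruction to membership that the proof uses.\<close>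

definition coset_sum :: "(bit^'n) set \<Rightarrow> bit^'n \<Rightarrow> ('n, 'a::field) mpoly \<Rightarrow> 'a" where
  "coset_sum C v f = (\<Sum>t\<in>Poly_Mapping.keys f. if parity t - v \<in> C then Poly_Mapping.lookup f t else 0)"

lemma coset_sum_superset:
  assumes "finite A" "Poly_Mapping.keys f \<subseteq> A"
  shows "coset_sum C v f = (\<Sum>t\<in>A. if parity t - v \<in> C then Poly_Mapping.lookup f t else 0)"
  unfolding coset_sum_def
  by (rule sum.mono_neutral_left) (use assms in \<open>auto simp: in_keys_iff\<close>)

lemma coset_sum_zero [simp]: "coset_sum C v 0 = 0"
  by (simp add: coset_sum_def)

lemma coset_sum_add: "coset_sum C v (f + g) = coset_sum C v f + coset_sum C v g"
proof -
  let ?A = "Poly_Mapping.keys f \<union> Poly_Mapping.keys g"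
  have "coset_sum C v h = (\<Sum>t\<in>?A. if parity t - v \<in> C then Poly_Mapping.lookup h t else 0)"
    if "Poly_Mapping.keys h \<subseteq> ?A" for h
    by (rule coset_sum_superset) (use that in auto)
  note * = this[of "f + g", OF Poly_Mapping.keys_add] this[of f, OF Un_upper1] this[of g, OF Un_upper2]
  show ?thesis
    unfolding *(1) *(2) *(3) by (subst sum.distrib[symmetric], rule sum.cong) (simp_all add: lookup_add)
qed

lemma coset_sum_single: "coset_sum C v (Poly_Mapping.single t a) = (if parity t - v \<in> C then a else 0)"
  by (subst coset_sum_superset[of "{t}"]) auto

lemma subspace_diff_cong:
  assumes "vec.subspace C" "u - v \<in> C"
  shows "u \<in> C \<longleftrightarrow> v \<in> C"
  using vec.subspace_add[OF assms(1), of "u - v" v] vec.subspace_diff[OF assms(1), of u "u - v"] assms(2)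
  by auto

text \<open>For a single term of \<open>f\<close> the product has coefficients \<open>a\<close> and
  \<open>- a\<close> at two monomials of one class, which cancel. Induction over the terms of
  \<open>f\<close> does the rest.\<close>

lemma coset_sum_mult_binomial:
  assumes C: "vec.subspace C" and "code_equiv C s t"
  shows "coset_sum C v (f * (mono_poly s - mono_poly t)) = 0"
proof (induction f rule: Poly_Mapping.update_induct)
  case const
  then show ?case by simp
next
  case (update f u a)
  have "(parity u + parity s - v) - (parity u + parity t - v) \<in> C"
    using assms(2) by (simp add: code_equiv_def)
  then have "(parity u + parity s - v \<in> C) = (parity u + parity t - v \<in> C)"
    by (rule subspace_diff_cong[OF C])
  moreover have "Poly_Mapping.update u a f = f + Poly_Mapping.single u a"
    using update by (intro poly_mapping_eqI) (auto simp: lookup_update lookup_add lookup_single when_def in_keys_iff)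
  moreover have "Poly_Mapping.single u a * (mono_poly s - mono_poly t)
      = Poly_Mapping.single (u + s) a + Poly_Mapping.single (u + t) (- a)"
    by (simp add: mono_poly_def right_diff_distrib mult_single single_uminus)
  ultimately show ?case
    using update by (simp add: distrib_right coset_sum_add coset_sum_single)
qed

abbreviation binomial_gens :: "(bit^'n) set \<Rightarrow> ('n, 'a::field) mpoly set" where
  "binomial_gens C \<equiv> {xpow c - xpow c' | c c'. c - c' \<in> C} \<union> {var i ^ 2 - 1 | i. True}"

text \<open>A single generating set makes span induction available for the whole ideal.\<close>

lemma code_ideal_eq:
  "(code_ideal C :: ('n::finite, 'a::field) mpoly set) = ideal_gen (binomial_gens C)"
proof -
  interpret module "(*) :: ('n, 'a) mpoly \<Rightarrow> _" by (rule module_self)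
  show ?thesis
    unfolding code_ideal_def ideal_sum_def ideal_gen_def span_Un by blast
qed

lemma square_binomial:
  "(var i ^ 2 - 1 :: ('n::finite, 'a::field) mpoly) =
    mono_poly (Poly_Mapping.single i 2) - mono_poly 0"
  by (simp add: var_def mono_poly_def power2_eq_square mult_single single_add[symmetric] flip: one_add_one)

lemma parity_square [simp]: "parity (Poly_Mapping.single i 2) = 0"
  by (auto simp: parity_def vec_eq_iff lookup_single when_def)

text \<open>Every generator is a difference of two equivalent monomials; for a square both parity
  vectors are zero. Hence all multiples of generators have coset sum zero.\<close>

lemma coset_sum_code_ideal:
  fixes f :: "('n::finite, 'a::field) mpoly"
  assumes C: "vec.subspace C" and "f \<in> code_ideal C"
  shows "coset_sum C v f = 0"
proof -
  interpret module "(*) :: ('n, 'a) mpoly \<Rightarrow> _" by (rule module_self)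
  have "f \<in> span (binomial_gens C)"
    using assms by (simp add: code_ideal_eq ideal_gen_def)
  then show ?thesis
  proof (induction rule: span_induct_alt)
    case base
    then show ?case by simp
  next
    case (step g b f)
    then have "\<exists>s t. b = mono_poly s - mono_poly t \<and> code_equiv C s t"
    proof (elim UnE)
      assume "b \<in> {xpow c - xpow c' | c c'. c - c' \<in> C}"
      then obtain c c' where "b = xpow c - xpow c'" "c - c' \<in> C"
        by blast
      then show ?thesis
        by (intro exI[of _ "bit_exp c"] exI[of _ "bit_exp c'"]) (simp add: xpow_def code_equiv_def)
    next
      assume "b \<in> {var i ^ 2 - 1 | i. True}"
      then obtain i where "b = mono_poly (Poly_Mapping.single i 2) - mono_poly 0"
        using square_binomial by blast
      moreover have "code_equiv C (Poly_Mapping.single i 2) 0"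
        using C by (simp add: code_equiv_def vec.subspace_0)
      ultimately show ?thesis by blast
    qed
    then have "coset_sum C v (g * b) = 0"
      using coset_sum_mult_binomial[OF C] by blast
    with step.IH show ?case
      by (simp add: coset_sum_add)
  qed
qed

text \<open>Modulo the squares each monomial equals the square-free monomial with its parity vector,
  and the square-free representatives of \<open>s\<close> and \<open>t\<close> differ by a
  generator.\<close>

lemma binomial_in_code_ideal:
  fixes s t :: "('n::finite) mon"
  assumes "code_equiv C s t"
  shows "mono_poly s - mono_poly t \<in> (code_ideal C :: ('n, 'a::field) mpoly set)"
proof -
  interpret module "(*) :: ('n, 'a) mpoly \<Rightarrow> _" by (rule module_self)
  let ?I = "span (binomial_gens C) :: ('n, 'a) mpoly set"
  have sq: "mono_poly t - mono_poly (bit_exp (parity t)) \<in> ?I" for t :: "'n mon"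
  proof (induction "mon_deg t" arbitrary: t rule: less_induct)
    case less
    show ?case
    proof (cases "\<forall>i. expo t i \<le> 1")
      case True
      then show ?thesis by (simp add: bit_exp_parity span_zero)
    next
      case False
      then obtain i where "2 \<le> expo t i"
        by (metis Suc_1 not_less_eq_eq One_nat_def)
      then obtain u where t: "t = u + Poly_Mapping.single i 2"
        by (metis single_dvd_iff mon_dvd_def add.commute)
      have "Poly_Mapping.single i (2::nat) \<noteq> 0"
        by (metis lookup_single_eq lookup_zero zero_neq_numeral)
      then have "mon_deg u < mon_deg t"
        using mon_deg_eq_0_iff[of "Poly_Mapping.single i 2"] by (simp add: t wdeg_add)
      then have 1: "mono_poly u - mono_poly (bit_exp (parity u)) \<in> ?I"
        by (rule less)
      have "(var i ^ 2 - 1) \<in> ?I"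
        by (rule span_base) blast
      then have 2: "mono_poly u * (var i ^ 2 - 1) \<in> ?I"
        by (rule span_scale)
      \<comment> \<open>Dropping the factor \<open>x_i^2\<close> keeps the parity and lowers the
        degree, so the induction hypothesis covers the remainder.\<close>
      have "mono_poly t - mono_poly (bit_exp (parity t))
          = mono_poly u * (var i ^ 2 - 1) + (mono_poly u - mono_poly (bit_exp (parity u)) :: ('n, 'a) mpoly)"
        unfolding square_binomial by (simp add: t right_diff_distrib flip: mono_poly_add)
      then show ?thesis using span_add[OF 2 1] by simp
    qed
  qed
  have "xpow (parity s) - xpow (parity t) \<in> ?I"
    by (rule span_base) (use assms in \<open>auto simp: code_equiv_def\<close>)
  from span_diff[OF span_add[OF sq[of s] this] sq[of t]]
  show ?thesis by (simp add: xpow_def code_ideal_eq ideal_gen_def)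
qed

section \<open>Reduced Groebner bases\<close>

locale code_order =
  fixes C :: "(bit^'n) set" and r :: "('n mon \<times> 'n mon) set"
  assumes subspace: "vec.subspace C"
    and order: "monomial_order r"
begin

text \<open>These turn out to be exactly the leading monomials of non-zero elements of the code
  ideal. The remaining, standard, monomials are the least elements of their classes.\<close>

definition nonstd :: "'n mon \<Rightarrow> bool" where
  "nonstd t \<longleftrightarrow> (\<exists>s. (s, t) \<in> r \<and> s \<noteq> t \<and> code_equiv C s t)"

text \<open>The minimal monomial generators of the leading ideal.\<close>

definition min_nonstd :: "'n mon \<Rightarrow> bool" where
  "min_nonstd t \<longleftrightarrow> nonstd t \<and> (\<forall>s. mon_dvd s t \<longrightarrow> nonstd s \<longrightarrow> s = t)"

section \<open>Properties of the order and of the classes\<close>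

lemma ord_refl [simp]: "(t, t) \<in> r"
  using order by (auto simp: monomial_order_def order_on_defs refl_on_def)

lemma ord_trans: "(s, t) \<in> r \<Longrightarrow> (t, u) \<in> r \<Longrightarrow> (s, u) \<in> r"
  using order by (auto simp: monomial_order_def order_on_defs dest: transD)

lemma ord_antisym: "(s, t) \<in> r \<Longrightarrow> (t, s) \<in> r \<Longrightarrow> s = t"
  using order by (auto simp: monomial_order_def order_on_defs dest: antisymD)

lemma ord_total: "(s, t) \<in> r \<or> (t, s) \<in> r"
  using order by (cases "s = t") (auto simp: monomial_order_def order_on_defs total_on_def)

lemma ord_zero [simp]: "(0, t) \<in> r"
  using order by (simp add: monomial_order_def)

lemma ord_add: "(s, t) \<in> r \<Longrightarrow> (s + u, t + u) \<in> r"
  using order by (simp add: monomial_order_def)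

lemma ord_dvd: "mon_dvd s t \<Longrightarrow> (s, t) \<in> r"
  using ord_add[of 0 _ s] by (auto simp: mon_dvd_def add.commute)

lemma equiv_refl [simp]: "code_equiv C t t"
  using subspace by (simp add: code_equiv_def vec.subspace_0)

lemma equiv_sym: "code_equiv C s t \<Longrightarrow> code_equiv C t s"
  using vec.subspace_neg[OF subspace, of "parity s - parity t"] by (simp add: code_equiv_def)

lemma equiv_trans: "code_equiv C s t \<Longrightarrow> code_equiv C t u \<Longrightarrow> code_equiv C s u"
  using vec.subspace_add[OF subspace, of "parity s - parity t" "parity t - parity u"]
  by (simp add: code_equiv_def)

lemma equiv_add_iff: "code_equiv C (s + u) (t + u) \<longleftrightarrow> code_equiv C s t"
  by (simp add: code_equiv_def)

lemma equiv_bit_exp_parity: "code_equiv C (bit_exp (parity t)) t"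
  using subspace by (simp add: code_equiv_def vec.subspace_0)

lemma nonstd_add: "nonstd t \<Longrightarrow> nonstd (t + u)"
  unfolding nonstd_def by (metis ord_add equiv_add_iff add_right_cancel)

lemma nonstd_dvd: "mon_dvd s t \<Longrightarrow> nonstd s \<Longrightarrow> nonstd t"
  unfolding mon_dvd_def using nonstd_add by blast

text \<open>By totality one of two distinct equivalent monomials lies above the other, so a class
  holds at most one standard monomial.\<close>

lemma equiv_cases:
  assumes "code_equiv C s t"
  obtains "s = t" | "nonstd s" | "nonstd t"
  using assms ord_total[of s t] equiv_sym unfolding nonstd_def by blast

lemma nonstd_of_equiv_zero: "code_equiv C t 0 \<Longrightarrow> t \<noteq> 0 \<Longrightarrow> nonstd t"
  unfolding nonstd_def using ord_zero equiv_sym by metis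

lemma finite_has_greatest:
  assumes "finite A" "A \<noteq> {}"
  shows "\<exists>t\<in>A. \<forall>s\<in>A. (s, t) \<in> r"
  using assms
proof (induction A rule: finite_ne_induct)
  case (insert a A)
  then obtain t where "t \<in> A" "\<forall>s\<in>A. (s, t) \<in> r" by blast
  then show ?case
    using ord_total[of a t] ord_trans by (metis insert_iff ord_refl)
qed simp

lemma finite_has_least:
  assumes "finite A" "A \<noteq> {}"
  shows "\<exists>t\<in>A. \<forall>s\<in>A. (t, s) \<in> r"
  using assms
proof (induction A rule: finite_ne_induct)
  case (insert a A)
  then obtain t where "t \<in> A" "\<forall>s\<in>A. (t, s) \<in> r" by blast
  then show ?case
    using ord_total[of a t] ord_trans by (metis insert_iff ord_refl)
qed simp

section \<open>Leading monomials and elements of a reduced basis\<close>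

lemma lead_mon_unique:
  "t \<in> Poly_Mapping.keys p \<Longrightarrow> \<forall>s\<in>Poly_Mapping.keys p. (s, t) \<in> r \<Longrightarrow> lead_mon r p = t"
  unfolding lead_mon_def by (rule the_equality) (auto intro: ord_antisym)

lemma lead_mon:
  assumes "p \<noteq> 0"
  shows "lead_mon r p \<in> Poly_Mapping.keys p" "\<forall>s\<in>Poly_Mapping.keys p. (s, lead_mon r p) \<in> r"
proof -
  have "Poly_Mapping.keys p \<noteq> {}" using assms by simp
  then obtain t where "t \<in> Poly_Mapping.keys p" "\<forall>s\<in>Poly_Mapping.keys p. (s, t) \<in> r"
    using finite_has_greatest[OF finite_keys] by blast
  with lead_mon_unique[OF this]
  show "lead_mon r p \<in> Poly_Mapping.keys p" "\<forall>s\<in>Poly_Mapping.keys p. (s, lead_mon r p) \<in> r"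
    by auto
qed

lemma lead_mon_binomial:
  assumes "(s, t) \<in> r" "s \<noteq> t"
  shows "lead_mon r (mono_poly t - mono_poly s :: ('n, 'a::field) mpoly) = t"
  by (rule lead_mon_unique) (use assms in \<open>auto simp: keys_binomial\<close>)

text \<open>The coset sum of the class of a key vanishes, so the key cannot be alone in its class.\<close>

lemma code_ideal_key_partner:
  assumes "f \<in> (code_ideal C :: ('n, 'a::field) mpoly set)" "t \<in> Poly_Mapping.keys f"
  shows "\<exists>s\<in>Poly_Mapping.keys f. s \<noteq> t \<and> code_equiv C s t"
proof (rule ccontr)
  assume "\<not> ?thesis"
  then have "(if parity s - parity t \<in> C then Poly_Mapping.lookup f s else 0)
      = (if s = t then Poly_Mapping.lookup f s else 0)" if "s \<in> Poly_Mapping.keys f" for s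
    using that subspace by (auto simp: code_equiv_def vec.subspace_0)
  then have "coset_sum C (parity t) f = (\<Sum>s\<in>Poly_Mapping.keys f. if s = t then Poly_Mapping.lookup f s else 0)"
    unfolding coset_sum_def by (rule sum.cong[OF refl])
  also have "\<dots> = Poly_Mapping.lookup f t"
    using assms(2) by simp
  finally show False
    using coset_sum_code_ideal[OF subspace assms(1), of "parity t"] assms(2) by (simp add: in_keys_iff)
qed

text \<open>The leading monomial has an equivalent partner among the keys, and that partner lies
  below it.\<close>

lemma nonstd_lead_mon:
  assumes "f \<in> (code_ideal C :: ('n, 'a::field) mpoly set)" "f \<noteq> 0"
  shows "nonstd (lead_mon r f)"
  using code_ideal_key_partner[OF assms(1) lead_mon(1)[OF assms(2)]] lead_mon(2)[OF assms(2)]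
  unfolding nonstd_def by blast

lemma binomial_nonzero: "s \<noteq> t \<Longrightarrow> (mono_poly t - mono_poly s :: ('n, 'a::field) mpoly) \<noteq> 0"
  by (metis keys_binomial insert_not_empty keys_zero)

text \<open>The binomial of \<open>t\<close> and a smaller equivalent monomial lies in the ideal and
  has leading monomial \<open>t\<close>.\<close>

lemma nonstd_mono_in_lead_ideal:
  assumes "nonstd t"
  shows "mono_poly t \<in> lead_ideal r (code_ideal C :: ('n, 'a::field) mpoly set)"
proof -
  interpret module "(*) :: ('n, 'a) mpoly \<Rightarrow> _" by (rule module_self)
  from assms obtain s where s: "(s, t) \<in> r" "s \<noteq> t" "code_equiv C t s"
    unfolding nonstd_def using equiv_sym by blast
  let ?f = "mono_poly t - mono_poly s :: ('n, 'a) mpoly"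
  have "mono_poly (lead_mon r ?f) \<in> lead_ideal r (code_ideal C :: ('n, 'a) mpoly set)"
    unfolding lead_ideal_def ideal_gen_def
    by (rule span_base) (use s binomial_in_code_ideal binomial_nonzero in blast)
  then show ?thesis
    using s by (simp add: lead_mon_binomial)
qed

lemma reduced_groebner_basis_nonzero:
  assumes "reduced_groebner_basis r I B" "g \<in> B"
  shows "g \<noteq> 0"
  using assms unfolding reduced_groebner_basis_def lead_coeff_def by (metis lookup_zero zero_neq_one)

text \<open>A monomial in an ideal generated by monomials is a multiple of one of these
  generators.\<close>

lemma reduced_groebner_basis_lead_dvd:
  assumes "reduced_groebner_basis r (code_ideal C :: ('n, 'a::field) mpoly set) B" "nonstd t"
  shows "\<exists>g\<in>B. mon_dvd (lead_mon r g) t"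
proof -
  have "mono_poly t \<in> lead_ideal r B"
    using nonstd_mono_in_lead_ideal[OF assms(2)] assms(1)
    by (simp add: reduced_groebner_basis_def groebner_basis_def)
  also have "lead_ideal r B = ideal_gen (mono_poly ` (lead_mon r ` {g \<in> B. g \<noteq> 0}))"
    unfolding lead_ideal_def by (simp add: image_image setcompr_eq_image)
  finally show ?thesis
    using mono_in_ideal_gen_dvd by blast
qed

text \<open>Reducedness makes the leading monomial minimal and all other keys standard. Standard
  monomials are pairwise inequivalent, so the vanishing coset sums leave room for one other key
  only, with coefficient \<open>- 1\<close>.\<close>

lemma reduced_groebner_basis_elem:
  assumes B: "reduced_groebner_basis r (code_ideal C :: ('n, 'a::field) mpoly set) B" and "g \<in> B"
  obtains t s where "min_nonstd t" "\<not> nonstd s" "code_equiv C s t" "g = mono_poly t - mono_poly s"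
proof -
  let ?t = "lead_mon r g"
  have g: "g \<in> code_ideal C" "g \<noteq> 0"
    using assms reduced_groebner_basis_nonzero
    by (auto simp: reduced_groebner_basis_def groebner_basis_def)
  note lead = lead_mon[OF g(2)]
  have red: "h = g" if "h \<in> B" "u \<in> Poly_Mapping.keys g" "mon_dvd (lead_mon r h) u" for h u
    using that assms unfolding reduced_groebner_basis_def by metis
  have nonstd_t: "nonstd ?t"
    by (rule nonstd_lead_mon[OF g])
  have tail: "\<not> nonstd s" if s: "s \<in> Poly_Mapping.keys g" "s \<noteq> ?t" for s
  proof
    assume "nonstd s"
    then obtain h where "h \<in> B" "mon_dvd (lead_mon r h) s"
      using reduced_groebner_basis_lead_dvd[OF B] by blast
    \<comment> \<open>Reducedness identifies \<open>h\<close> with \<open>g\<close>, so the leading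
      monomial of \<open>g\<close> would divide a smaller key.\<close>
    with red s have "mon_dvd ?t s" by blast
    then show False
      using ord_dvd lead(2) s ord_antisym by blast
  qed
  have "min_nonstd ?t"
    unfolding min_nonstd_def
  proof (intro conjI allI impI)
    fix s
    assume s: "mon_dvd s ?t" "nonstd s"
    then obtain h where h: "h \<in> B" "mon_dvd (lead_mon r h) s"
      using reduced_groebner_basis_lead_dvd[OF B] by blast
    with red[OF _ lead(1)] s have "h = g"
      using mon_dvd_trans by blast
    then show "s = ?t"
      using h s mon_dvd_antisym by blast
  qed (rule nonstd_t)
  obtain s where s: "s \<in> Poly_Mapping.keys g" "s \<noteq> ?t" "code_equiv C s ?t"
    using code_ideal_key_partner[OF g(1) lead(1)] by blast
  have std: "\<not> nonstd s"
    by (rule tail[OF s(1,2)])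
  have keys: "Poly_Mapping.keys g = {?t, s}"
  proof (rule ccontr)
    assume "Poly_Mapping.keys g \<noteq> {?t, s}"
    then obtain u where u: "u \<in> Poly_Mapping.keys g" "u \<noteq> ?t" "u \<noteq> s"
      using s(1) lead(1) by blast
    \<comment> \<open>\<open>u\<close> would have no partner: it is not equivalent to another
      standard key, and \<open>?t\<close> belongs to the class of \<open>s\<close>.\<close>
    have "\<not> code_equiv C u s"
      using equiv_cases tail u std by metis
    then have "\<not> code_equiv C ?t u"
      using s(3) equiv_sym equiv_trans by blast
    then show False
      using code_ideal_key_partner[OF g(1) u(1)] equiv_cases tail u by metis
  qed
  have lc: "Poly_Mapping.lookup g ?t = 1"
    using assms by (simp add: reduced_groebner_basis_def lead_coeff_def)
  \<comment> \<open>Both keys lie in the class of \<open>s\<close>, so its coset sum adds the two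
    coefficients.\<close>
  have "coset_sum C (parity s) g = 1 + Poly_Mapping.lookup g s"
    unfolding coset_sum_def keys using s equiv_sym[OF s(3)] lc equiv_refl[of s]
    by (simp add: code_equiv_def)
  then have "1 + Poly_Mapping.lookup g s = 0"
    using coset_sum_code_ideal[OF subspace g(1)] by metis
  then have "Poly_Mapping.lookup g s = - 1"
    by (metis neg_eq_iff_add_eq_0)
  then have "g = mono_poly ?t - mono_poly s"
    using keys s(2) lc
    by (intro poly_mapping_eqI) (simp add: lookup_minus lookup_mono_poly set_eq_iff in_keys_iff, metis)
  with that \<open>min_nonstd ?t\<close> std s(3) show thesis
    by blast
qed

text \<open>Every monomial is divisible by a square-free one of its own class. The least of the
  finitely many square-free members is therefore least in the whole class, and well-foundedness of
  the order is not invoked.\<close>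

lemma ex_normal_form: "\<exists>s. \<not> nonstd s \<and> code_equiv C s t"
proof -
  let ?A = "{s \<in> range bit_exp. code_equiv C s t}"
  have "finite (range (bit_exp :: bit^'n \<Rightarrow> _))"
    by (rule finite_imageI) (rule finite_bit_vec)
  moreover have "bit_exp (parity t) \<in> ?A"
    using equiv_bit_exp_parity by blast
  ultimately obtain s where s: "s \<in> ?A" "\<forall>u\<in>?A. (s, u) \<in> r"
    using finite_has_least[of ?A] by (metis (no_types, lifting) empty_iff finite_subset mem_Collect_eq subsetI)
  have "(s, u) \<in> r" if "code_equiv C u s" for u
  proof -
    have "bit_exp (parity u) \<in> ?A"
      using equiv_trans[OF equiv_bit_exp_parity equiv_trans[OF that]] s(1) by blast
    then show ?thesis
      using s(2) ord_trans ord_dvd[OF bit_exp_parity_dvd] by blast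
  qed
  then have "\<not> nonstd s"
    unfolding nonstd_def using ord_antisym by blast
  with s(1) show ?thesis by blast
qed

text \<open>A nonstandard divisor of least total degree is minimal for divisibility.\<close>

lemma ex_min_nonstd_dvd:
  assumes "nonstd t"
  shows "\<exists>s. min_nonstd s \<and> mon_dvd s t"
proof -
  obtain s where s: "nonstd s" "mon_dvd s t"
    and least: "\<And>u. nonstd u \<Longrightarrow> mon_dvd u t \<Longrightarrow> mon_deg s \<le> mon_deg u"
    using ex_has_least_nat[of "\<lambda>s. nonstd s \<and> mon_dvd s t" t mon_deg] assms by auto
  have "u = s" if u: "mon_dvd u s" "nonstd u" for u
  proof -
    obtain w where w: "s = u + w"
      using u(1) by (auto simp: mon_dvd_def)
    have "mon_deg s \<le> mon_deg u"
      using least u s(2) mon_dvd_trans by blast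
    then have "mon_deg w = 0"
      using w by (simp add: wdeg_add)
    then have "w = 0"
      by (simp only: mon_deg_eq_0_iff)
    then show ?thesis using w by simp
  qed
  then show ?thesis
    using s unfolding min_nonstd_def by blast
qed

lemma nonstd_square: "nonstd (Poly_Mapping.single i 2)"
proof (rule nonstd_of_equiv_zero)
  show "Poly_Mapping.single i 2 \<noteq> (0 :: 'n mon)"
    by (metis lookup_single_eq lookup_zero zero_neq_numeral)
qed (use subspace in \<open>simp add: code_equiv_def vec.subspace_0\<close>)

lemma min_nonstd_cases:
  assumes "min_nonstd t"
  obtains i where "t = Poly_Mapping.single i 2" | u where "t = bit_exp u"
proof (cases "\<forall>i. expo t i \<le> 1")
  case True
  then show thesis using that(2) bit_exp_parity by metis
next
  case False
  then obtain i where "2 \<le> expo t i"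
    by (metis Suc_1 not_less_eq_eq One_nat_def)
  then have "mon_dvd (Poly_Mapping.single i 2) t"
    by (simp add: single_dvd_iff)
  then show thesis
    using that(1) assms nonstd_square unfolding min_nonstd_def by metis
qed

text \<open>This makes the reduced basis constructed next finite.\<close>

lemma finite_min_nonstd: "finite {t. min_nonstd t}"
proof (rule finite_subset)
  show "{t. min_nonstd t} \<subseteq> range (\<lambda>i. Poly_Mapping.single i 2) \<union> range bit_exp"
    using min_nonstd_cases by blast
  show "finite (range (\<lambda>i. Poly_Mapping.single i 2 :: 'n mon) \<union> range (bit_exp :: bit^'n \<Rightarrow> _))"
    by (simp add: finite_bit_vec)
qed

text \<open>The binomials formed by each minimal nonstandard monomial and its normal form are shown
  to be a reduced basis, and the given binomial is one of them.\<close>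

lemma ex_reduced_groebner_basis:
  assumes t: "min_nonstd t" and s: "\<not> nonstd s" "code_equiv C s t"
  shows "\<exists>B. reduced_groebner_basis r (code_ideal C :: ('n, 'a::field) mpoly set) B
    \<and> mono_poly t - mono_poly s \<in> B"
proof -
  interpret module "(*) :: ('n, 'a) mpoly \<Rightarrow> _" by (rule module_self)
  let ?I = "code_ideal C :: ('n, 'a) mpoly set"
  define nf where "nf t = (SOME s. \<not> nonstd s \<and> code_equiv C s t)" for t
  have nf: "\<not> nonstd (nf t)" "code_equiv C (nf t) t" for t
    using someI_ex[OF ex_normal_form[of t]] by (auto simp: nf_def)
  define b :: "'n mon \<Rightarrow> ('n, 'a) mpoly" where "b t = mono_poly t - mono_poly (nf t)" for t
  define B where "B = b ` {t. min_nonstd t}"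
  \<comment> \<open>The arbitrary choice in \<open>nf\<close> is immaterial, since a class has only
    one standard monomial.\<close>
  have "nf t = s"
    using nf[of t] s equiv_cases[of "nf t" s] equiv_trans equiv_sym by metis
  then have "mono_poly t - mono_poly s \<in> B"
    using t by (auto simp: B_def b_def)
  moreover have "reduced_groebner_basis r ?I B"
  proof -
    have neq: "nf t \<noteq> t" and less: "(nf t, t) \<in> r" if "min_nonstd t" for t
    proof -
      show "nf t \<noteq> t" using nf[of t] that by (auto simp: min_nonstd_def)
      then show "(nf t, t) \<in> r"
        using nf[of t] ord_total[of t "nf t"] equiv_sym unfolding nonstd_def by metis
    qed
    have keys: "Poly_Mapping.keys (b t) = {t, nf t}" and lead: "lead_mon r (b t) = t"
      and nz: "b t \<noteq> 0" if "min_nonstd t" for t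
      unfolding b_def using neq[OF that] less[OF that]
      by (simp_all add: keys_binomial lead_mon_binomial binomial_nonzero del: right_minus_eq)
    have "b t \<in> ?I" for t
      unfolding b_def by (rule binomial_in_code_ideal[OF equiv_sym[OF nf(2)]])
    then have BI: "B \<subseteq> ?I"
      by (auto simp: B_def)
    have "lead_ideal r ?I \<subseteq> lead_ideal r B"
      unfolding lead_ideal_def ideal_gen_def
    proof (rule span_minimal)
      show "{mono_poly (lead_mon r f) |f. f \<in> ?I \<and> f \<noteq> 0} \<subseteq> span {mono_poly (lead_mon r f) |f. f \<in> B \<and> f \<noteq> 0}"
      proof clarify
        fix f :: "('n, 'a) mpoly"
        assume "f \<in> ?I" "f \<noteq> 0"
        \<comment> \<open>The leading monomial of \<open>f\<close> is a multiple of some minimal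
          \<open>u\<close>, which is the leading monomial of \<open>b u\<close>.\<close>
        then obtain u w where u: "min_nonstd u" "lead_mon r f = w + u"
          using ex_min_nonstd_dvd[OF nonstd_lead_mon] by (metis mon_dvd_def add.commute)
        have "mono_poly u \<in> span {mono_poly (lead_mon r f) |f. f \<in> B \<and> f \<noteq> 0}"
          by (rule span_base) (use u(1) lead nz in \<open>force simp: B_def\<close>)
        then show "mono_poly (lead_mon r f) \<in> span {mono_poly (lead_mon r f) |f. f \<in> B \<and> f \<noteq> 0}"
          unfolding u(2) mono_poly_add by (rule span_scale)
      qed
    qed simp
    moreover have "lead_ideal r B \<subseteq> lead_ideal r ?I"
      unfolding lead_ideal_def ideal_gen_def by (rule span_mono) (use BI in blast)
    ultimately have "groebner_basis r ?I B"
      using BI finite_min_nonstd by (auto simp: groebner_basis_def B_def)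
    moreover have "lead_coeff r g = 1" if "g \<in> B" for g
      using that neq[symmetric] by (auto simp: B_def lead_coeff_def lead) (simp add: b_def lookup_minus lookup_mono_poly)
    moreover have "\<not> mon_dvd (lead_mon r g) u"
      if gh: "g \<in> B" "h \<in> B" "g \<noteq> h" "u \<in> Poly_Mapping.keys h" for g h u
    proof -
      obtain p q where p: "min_nonstd p" "g = b p" and q: "min_nonstd q" "h = b q"
        using gh by (auto simp: B_def)
      \<comment> \<open>Divisors of a standard monomial are standard, while \<open>p\<close> is not;
        distinct minimal monomials do not divide one another.\<close>
      have "\<not> mon_dvd p (nf q)"
        using nf(1)[of q] nonstd_dvd p(1) unfolding min_nonstd_def by blast
      moreover have "\<not> mon_dvd p q"
        using p q gh(3) unfolding min_nonstd_def by blast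
      ultimately show ?thesis
        using gh(4) p q by (auto simp: keys lead)
    qed
    ultimately show ?thesis
      unfolding reduced_groebner_basis_def by blast
  qed
  ultimately show ?thesis by blast
qed

end

text \<open>Reduces the problem to the combinatorics of orders and classes: from here on no ideal or
  basis has to be examined.\<close>

lemma universal_groebner_basis_code_ideal:
  assumes "vec.subspace C"
  shows "universal_groebner_basis (code_ideal C :: ('n::finite, 'a::field) mpoly set) =
    {mono_poly t - mono_poly s | r t s. monomial_order r \<and> code_order.min_nonstd C r t \<and>
       \<not> code_order.nonstd C r s \<and> code_equiv C s t}"
    (is "?U = ?R")
proof
  show "?U \<subseteq> ?R"
  proof
    fix g
    assume "g \<in> ?U"
    then obtain r B where r: "monomial_order r"
      and B: "reduced_groebner_basis r (code_ideal C :: ('n, 'a) mpoly set) B" "g \<in> B"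
      unfolding universal_groebner_basis_def by blast
    interpret code_order C r
      by unfold_locales (fact assms r)+
    show "g \<in> ?R"
      using reduced_groebner_basis_elem[OF B] r by blast
  qed
  show "?R \<subseteq> ?U"
  proof clarify
    fix r t s
    assume r: "monomial_order r" and *: "code_order.min_nonstd C r t" "\<not> code_order.nonstd C r s" "code_equiv C s t"
    interpret code_order C r
      by unfold_locales (fact assms r)+
    show "mono_poly t - mono_poly s \<in> ?U"
      using ex_reduced_groebner_basis[OF *] r unfolding universal_groebner_basis_def by blast
  qed
qed

section \<open>Minimal codewords\<close>

text \<open>The projection to the coordinates in \<open>A\<close>, kept as an endomorphism of the
  full space to match the zero columns of \<open>col_submatrix\<close>.\<close>

definition restrict_vec :: "'n set \<Rightarrow> bit^'n \<Rightarrow> bit^'n" where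
  "restrict_vec A u = (\<chi> i. if i \<in> A then u $ i else 0)"

lemma supp_restrict_vec: "supp (restrict_vec A u) = A \<inter> supp u"
  by (auto simp: restrict_vec_def supp_def)

lemma restrict_vec_add_disjoint:
  assumes "supp u \<subseteq> A \<union> B" "A \<inter> B = {}"
  shows "restrict_vec A u + restrict_vec B u = u"
proof -
  have "restrict_vec A u $ i + restrict_vec B u $ i = u $ i" for i
    using assms by (cases "u $ i") (auto simp: restrict_vec_def supp_def subset_iff)
  then show ?thesis
    by (simp add: vec_eq_iff)
qed

text \<open>A binary word is determined by its support, so these are the codewords of
  inclusion-minimal non-empty support: the cocircuits of the column matroid of a generator
  matrix.\<close>

definition minimal_word :: "(bit^'n) set \<Rightarrow> bit^'n \<Rightarrow> bool" where
  "minimal_word C u \<longleftrightarrow> u \<in> C \<and> u \<noteq> 0 \<and> (\<forall>w\<in>C. supp w \<subseteq> supp u \<longrightarrow> w = 0 \<or> w = u)"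

text \<open>A basis \<open>A\<close> of the kernel within \<open>S\<close> is extended to a basis
  \<open>B\<close> of \<open>S\<close>; then \<open>f\<close> is injective on the span of
  \<open>B - A\<close> and maps it onto the image of \<open>S\<close>.\<close>

lemma vec_rank_nullity:
  fixes f :: "'a::field^'n \<Rightarrow> 'a^'m"
  assumes f: "Vector_Spaces.linear (*s) (*s) f" and S: "vec.subspace S"
  shows "vec.dim {x\<in>S. f x = 0} + vec.dim (f ` S) = vec.dim S"
proof -
  interpret f: Vector_Spaces.linear "(*s)" "(*s)" f by fact
  let ?K = "{x\<in>S. f x = 0}"
  obtain A where A: "A \<subseteq> ?K" "vec.independent A" "?K \<subseteq> vec.span A" "card A = vec.dim ?K"
    using vec.basis_exists[of ?K] by auto
  obtain B where B: "A \<subseteq> B" "B \<subseteq> S" "vec.independent B" "S \<subseteq> vec.span B"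
    using vec.maximal_independent_subset_extend[of A S] A by blast
  let ?D = "B - A"
  have fin: "finite B" by (rule vec.finiteI_independent[OF B(3)])
  have indD: "vec.independent ?D"
    using B(3) vec.independent_mono by blast
  have AD: "A \<union> ?D = B" using B(1) by blast
  have "vec.dim {x + y |x y. x \<in> vec.span A \<and> y \<in> vec.span ?D} = card B"
    using vec.dim_eq_card_independent[OF B(3)] unfolding vec.span_Un[symmetric] AD by simp
  \<comment> \<open>The dimension formula for a sum of subspaces, where the dimensions of the
    summands add up to \<open>card B\<close>.\<close>
  then have "vec.dim (vec.span A \<inter> vec.span ?D) = 0"
    using vec.dim_sums_Int[of "vec.span A" "vec.span ?D"] fin B(1)
      vec.dim_eq_card_independent[OF A(2)] vec.dim_eq_card_independent[OF indD]
      card_Diff_subset[of A B] card_mono[OF fin B(1)] finite_subset[OF B(1) fin]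
    by simp
  then have int: "vec.span A \<inter> vec.span ?D \<subseteq> {0}"
    by simp
  have DS: "vec.span ?D \<subseteq> S"
    using B(2) S by (intro vec.span_minimal) auto
  have "inj_on f (vec.span ?D)"
  proof (rule inj_onI)
    fix x y
    assume xy: "x \<in> vec.span ?D" "y \<in> vec.span ?D" "f x = f y"
    then have "x - y \<in> vec.span ?D" by (simp add: vec.span_diff)
    moreover from this have "x - y \<in> vec.span A"
      using xy A(3) DS by (auto simp: f.diff)
    ultimately show "x = y" using int by auto
  qed
  then have "vec.dim (f ` ?D) = card ?D"
    using vec.dim_image_eq[OF f] vec.dim_eq_card_independent[OF indD] by simp
  moreover have "vec.dim (f ` S) = vec.dim (f ` ?D)"
  proof (rule vec.span_eq_dim)
    have "f a = 0" if "a \<in> A" for a using that A(1) by blast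
    \<comment> \<open>\<open>f\<close> kills \<open>A\<close>, so the images of \<open>?D\<close>
      already span the image of \<open>S\<close>.\<close>
    then have "f ` B \<subseteq> insert 0 (f ` ?D)" by blast
    then have "vec.span (f ` B) \<subseteq> vec.span (f ` ?D)"
      by (metis vec.span_mono vec.span_insert_0)
    moreover have "vec.span B = S"
      using B S by (metis vec.span_subspace)
    ultimately have "f ` S \<subseteq> vec.span (f ` ?D)"
      by (metis f.span_image)
    then show "vec.span (f ` S) = vec.span (f ` ?D)"
      using B(2) by (metis Diff_subset image_mono order.trans vec.span_eq vec.span_superset)
  qed
  ultimately show ?thesis
    using card_Diff_subset[of A B] card_mono[OF fin B(1)] finite_subset[OF B(1) fin] A(4)
      vec.dim_eq_card[of B S] B S vec.span_subspace[OF B(2,4) S] vec.span_eq_iff[of S]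
    by (metis B(3) add_diff_inverse_nat le_antisym less_imp_not_less not_le vec.dim_eq_card)
qed

section \<open>Ranks of column submatrices and minimal codewords\<close>

lemma linear_restrict_vec: "Vector_Spaces.linear (*s) (*s) (restrict_vec A)"
  by unfold_locales (auto simp: restrict_vec_def vec_eq_iff)

lemma rows_col_submatrix: "rows (col_submatrix G J) = restrict_vec J ` rows G"
proof -
  have "row i (col_submatrix G J) = restrict_vec J (row i G)" for i
    by (simp add: row_def col_submatrix_def restrict_vec_def vec_eq_iff)
  then show ?thesis
    unfolding rows_def by auto
qed

text \<open>Rank is row rank, and the restricted rows of \<open>G\<close> span the restriction of
  \<open>C\<close>.\<close>

lemma rank_col_submatrix:
  assumes "generator_matrix G C"
  shows "rank (col_submatrix G J) = vec.dim (restrict_vec J ` C)"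
proof -
  interpret Vector_Spaces.linear "(*s)" "(*s)" "restrict_vec J"
    by (rule linear_restrict_vec)
  have "restrict_vec J ` C = vec.span (restrict_vec J ` rows G)"
    using assms span_image unfolding generator_matrix_def by metis
  then show ?thesis
    by (simp add: row_rank_def_gen rows_col_submatrix)
qed

lemma rank_col_submatrix_le:
  fixes G :: "bit^'n^'k"
  assumes "generator_matrix G C"
  shows "rank (col_submatrix G J) \<le> card J"
proof -
  have "restrict_vec J u \<in> vec.span ((\<lambda>i. axis i 1) ` J)" for u
  proof -
    have "restrict_vec J u = (\<Sum>i\<in>J. u $ i *s axis i 1)"
      by (auto simp: vec_eq_iff restrict_vec_def axis_def if_distrib cong: if_cong)
    then show ?thesis
      by (simp only:) (intro vec.span_sum vec.span_scale vec.span_base imageI)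
  qed
  then have "restrict_vec J ` C \<subseteq> vec.span ((\<lambda>i. axis i 1) ` J)"
    by blast
  then have "vec.dim (restrict_vec J ` C) \<le> card ((\<lambda>i. axis i 1 :: bit^'n) ` J)"
    by (rule vec.dim_le_card) simp
  also have "\<dots> \<le> card J"
    by (rule card_image_le) simp
  finally show ?thesis
    by (simp add: rank_col_submatrix[OF assms])
qed

lemma vec_dim_eq_1_iff:
  fixes S :: "(bit^'n) set"
  assumes "vec.subspace S" "u \<in> S" "u \<noteq> 0"
  shows "vec.dim S = 1 \<longleftrightarrow> S = {0, u}"
proof -
  have ind: "vec.independent {u}"
    using assms(3) by simp
  have "a *s u \<in> {0, u}" for a
    by (cases a) auto
  then have span: "vec.span {u} = {0, u}"
    using vec.span_zero[of "{u}"] vec.span_base[of u "{u}"] by (auto simp: vec.span_singleton)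
  show ?thesis
  proof
    assume "S = {0, u}"
    then show "vec.dim S = 1"
      using vec.dim_span_eq_card_independent[OF ind] span by simp
  next
    assume "vec.dim S = 1"
    then have "vec.span {u} = S"
      using assms(1,2) vec.dim_span_eq_card_independent[OF ind]
      by (intro vec.subspace_dim_equal vec.span_minimal) auto
    then show "S = {0, u}"
      using span by simp
  qed
qed

text \<open>The kernel of the restriction to \<open>UNIV - supp u\<close> consists of the codewords
  supported in \<open>supp u\<close>. It contains \<open>u\<close>, and it is one-dimensional
  exactly if \<open>u\<close> is minimal, so rank-nullity gives the equivalence. The weight bound
  holds because a rank is at most the number of columns left.\<close>

lemma
  fixes C :: "(bit^'n) set" and G :: "bit^'n^'k"
  assumes C: "binary_code CARD('k) C" and G: "generator_matrix G C" and u: "u \<in> C" "u \<noteq> 0"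
  shows rank_eq_iff_minimal_word:
      "rank (col_submatrix G (UNIV - supp u)) = CARD('k) - 1 \<longleftrightarrow> minimal_word C u" (is ?th1)
    and wt_minimal_word: "minimal_word C u \<Longrightarrow> wt u \<le> CARD('n) - CARD('k) + 1"
proof -
  let ?J = "UNIV - supp u"
  let ?K = "{w\<in>C. restrict_vec ?J w = 0}"
  interpret Vector_Spaces.linear "(*s)" "(*s)" "restrict_vec ?J"
    by (rule linear_restrict_vec)
  have sub: "vec.subspace C" and dim: "vec.dim C = CARD('k)"
    using C by (auto simp: binary_code_def)
  have K: "?K = {w\<in>C. supp w \<subseteq> supp u}"
    unfolding supp_eq_empty_iff[symmetric] supp_restrict_vec by blast
  have "vec.subspace ?K"
    by (rule vec.subspaceI) (use sub in \<open>auto simp: zero add scale vec.subspace_0 vec.subspace_add vec.subspace_scale\<close>)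
  moreover have uK: "u \<in> ?K"
    unfolding K using u by simp
  ultimately have dim1: "vec.dim ?K = 1 \<longleftrightarrow> ?K = {0, u}"
    using u(2) by (rule vec_dim_eq_1_iff)
  have "vec.dim ?K \<noteq> 0"
    using uK u(2) by auto
  moreover have sum: "vec.dim ?K + rank (col_submatrix G ?J) = CARD('k)"
    using vec_rank_nullity[OF linear_restrict_vec sub] dim rank_col_submatrix[OF G] by metis
  \<comment> \<open>A non-zero kernel dimension keeps the truncated subtraction harmless.\<close>
  ultimately have "rank (col_submatrix G ?J) = CARD('k) - 1 \<longleftrightarrow> vec.dim ?K = 1"
    by linarith
  also have "\<dots> \<longleftrightarrow> minimal_word C u"
    unfolding dim1 unfolding K minimal_word_def using u vec.subspace_0[OF sub] by auto
  finally show th1: ?th1 .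
  assume "minimal_word C u"
  with th1 have "CARD('k) - 1 \<le> card ?J"
    using rank_col_submatrix_le[OF G, of ?J] by simp
  moreover have "card ?J = CARD('n) - wt u"
    by (simp add: wt_def card_Diff_subset)
  moreover have "wt u \<le> CARD('n)"
    unfolding wt_def by (rule card_mono) auto
  ultimately show "wt u \<le> CARD('n) - CARD('k) + 1"
    by linarith
qed

section \<open>From reduced basis elements to minimal codewords\<close>

context code_order
begin

lemma min_nonstd_add:
  assumes "min_nonstd (s + u)" "nonstd s"
  shows "u = 0"
proof -
  have "mon_dvd s (s + u)" by (auto simp: mon_dvd_def)
  with assms have "s = s + u" unfolding min_nonstd_def by blast
  then show ?thesis by simp
qed

lemma not_nonstd_zero: "\<not> nonstd 0"
  unfolding nonstd_def using ord_antisym[OF _ ord_zero] by blast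

text \<open>The recurring device is to split a codeword into two parts with equivalent monomials:
  these are equal or one is nonstandard, and divisors of \<open>s\<close> and proper divisors of
  \<open>t\<close> are standard.\<close>

lemma min_nonstd_binomial_cases:
  assumes no_weight_one: "\<forall>u\<in>C. wt u \<noteq> 1"
    and t: "min_nonstd t" and s: "\<not> nonstd s" and st: "code_equiv C s t"
  obtains (square) i where "t = Poly_Mapping.single i 2" "s = 0"
  | (word) c c' where "t = bit_exp c" "s = bit_exp c'" "c \<noteq> 0" "c' \<noteq> 0" "supp c \<inter> supp c' = {}"
      "minimal_word C (c - c')"
  using t
proof (cases rule: min_nonstd_cases)
  case (1 i)
  \<comment> \<open>A square has parity zero, so \<open>s\<close> is the least element of the class
    of \<open>0\<close>.\<close>
  then have "code_equiv C s 0"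
    using st by (simp add: code_equiv_def)
  then have "s = 0"
    using nonstd_of_equiv_zero s by blast
  with 1 square show thesis by blast
next
  case (2 c)
  define c' where "c' = parity s"
  have "expo s i \<le> 1" for i
  proof (rule ccontr)
    assume "\<not> expo s i \<le> 1"
    then have "mon_dvd (Poly_Mapping.single i 2) s"
      by (simp add: single_dvd_iff)
    then show False
      using nonstd_dvd nonstd_square s by blast
  qed
  then have s': "s = bit_exp c'"
    unfolding c'_def by (metis bit_exp_parity)
  have nt: "nonstd t" using t by (simp add: min_nonstd_def)
  have single_nz: "Poly_Mapping.single i (1::nat) \<noteq> 0" for i :: 'n
    by (metis lookup_single_eq lookup_zero zero_neq_one)
  have split: "\<exists>t'. t = Poly_Mapping.single i 1 + t'" if "i \<in> supp c" for i
    using that single_dvd_iff[of i 1 t] by (simp add: 2 supp_def mon_dvd_def)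
  have split': "\<exists>s'. s = Poly_Mapping.single i 1 + s'" if "i \<in> supp c'" for i
    using that single_dvd_iff[of i 1 s] by (simp add: s' supp_def mon_dvd_def)
  \<comment> \<open>A common variable could be cancelled, leaving equivalent \<open>s'\<close> and
    \<open>t'\<close>. They cannot be equal, and neither can be nonstandard.\<close>
  have disj: "supp c \<inter> supp c' = {}"
  proof (rule ccontr)
    assume "supp c \<inter> supp c' \<noteq> {}"
    then obtain i t' s' where i: "t = Poly_Mapping.single i 1 + t'" "s = Poly_Mapping.single i 1 + s'"
      using split split' by blast
    then have "code_equiv C s' t'"
      using st equiv_add_iff by (simp add: add.commute)
    then show False
    proof (cases rule: equiv_cases)
      case 1
      then show False using i nt s by simp
    next
      case 2
      then show False using s nonstd_add i(2) by (metis add.commute)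
    next
      case 3
      then show False using t i(1) min_nonstd_add single_nz by (metis add.commute)
    qed
  qed
  have c0: "c \<noteq> 0"
    using nt 2 not_nonstd_zero by auto
  have inC: "c - c' \<in> C"
    using equiv_sym[OF st] by (simp add: code_equiv_def 2 s')
  \<comment> \<open>Otherwise \<open>c\<close> is a codeword, and splitting off one variable makes
    that variable equivalent to the cofactor \<open>t'\<close>. The only way out is
    \<open>t' = 0\<close>, when \<open>c\<close> has weight one.\<close>
  have c'0: "c' \<noteq> 0"
  proof
    assume "c' = 0"
    then have cC: "c \<in> C" using inC by simp
    from c0 obtain i where "i \<in> supp c"
      using supp_eq_empty_iff by blast
    then obtain t' where t': "t = Poly_Mapping.single i 1 + t'"
      using split by blast
    have "parity (Poly_Mapping.single i 1) + parity t' = c"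
      using 2 t' by (metis parity_add parity_bit_exp)
    then have sum: "parity (Poly_Mapping.single i 1) - parity t' = c"
      by (simp add: bit_vec_diff)
    then have "code_equiv C (Poly_Mapping.single i 1) t'"
      using cC by (simp add: code_equiv_def)
    then show False
    proof (cases rule: equiv_cases)
      case 1
      then show False using sum c0 by simp
    next
      case 2
      then have "t' = 0"
        using t t' min_nonstd_add by blast
      then have "bit_exp c = bit_exp (axis i 1)"
        using t' \<open>t = bit_exp c\<close> bit_exp_axis by (metis add_0_right)
      then have "wt c = 1"
        by (simp add: wt_def supp_axis)
      then show False
        using cC no_weight_one by blast
    next
      case 3
      then show False using t t' min_nonstd_add single_nz by (metis add.commute)
    qed
  qed
  have suppu: "supp (c - c') = supp c \<union> supp c'"
    using disj by (simp add: bit_vec_diff supp_add)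
  have "w = 0 \<or> w = c - c'" if w: "w \<in> C" "supp w \<subseteq> supp (c - c')" for w
  proof -
    let ?a = "restrict_vec (supp c) w" and ?b = "restrict_vec (supp c') w"
    have ab: "?a + ?b = w"
      using w(2) disj by (intro restrict_vec_add_disjoint) (auto simp: suppu)
    have b_std: "\<not> nonstd (bit_exp v)" if "supp v \<subseteq> supp c'" for v
      using nonstd_dvd s that unfolding s' by (metis mon_dvd_bit_exp_iff)
    have "code_equiv C (bit_exp ?a) (bit_exp ?b)"
      using w(1) ab by (simp add: code_equiv_def bit_vec_diff)
    then show ?thesis
    proof (cases rule: equiv_cases)
      case 1
      then have "w = 0" using ab by simp
      then show ?thesis ..
    next
      case 2
      moreover have "mon_dvd (bit_exp ?a) t"
        by (simp add: \<open>t = bit_exp c\<close> mon_dvd_bit_exp_iff supp_restrict_vec)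
      ultimately have a: "?a = c"
        using t \<open>t = bit_exp c\<close> unfolding min_nonstd_def by (metis bit_exp_inject)
      \<comment> \<open>The rest of \<open>c - c'\<close> outside \<open>w\<close> is a codeword
        supported in \<open>supp c'\<close>. Its monomial is standard and equivalent to
        \<open>0\<close>, hence trivial.\<close>
      have "c' + ?b = (c - c') - w"
        using ab a by (metis bit_vec_diff add.commute add.left_commute add_diff_cancel_left)
      then have "c' + ?b \<in> C"
        using vec.subspace_diff[OF subspace inC w(1)] by (simp only:)
      then have "code_equiv C (bit_exp (c' + ?b)) 0"
        by (simp add: code_equiv_def)
      moreover have "\<not> nonstd (bit_exp (c' + ?b))"
        by (rule b_std) (auto simp: supp_add supp_restrict_vec)
      ultimately have "c' + ?b = 0"
        using nonstd_of_equiv_zero by (metis bit_exp_eq_0_iff)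
      then have "?b = c'"
        by (metis add_left_cancel bit_vec_add_self)
      then show ?thesis
        using ab a by (simp add: bit_vec_diff)
    next
      case 3
      moreover have "\<not> nonstd (bit_exp ?b)"
        by (rule b_std) (auto simp: supp_restrict_vec)
      ultimately show ?thesis by blast
    qed
  qed
  moreover have "c - c' \<noteq> 0"
    using c0 disj by auto
  ultimately have "minimal_word C (c - c')"
    using inC unfolding minimal_word_def by blast
  then show thesis
    using word 2 s' c0 c'0 disj by blast
qed

end

section \<open>Weighted monomial orders\<close>

text \<open>The lexicographic order. The type of variables carries no order, so an injection
  \<open>h\<close> into the naturals ranks them.\<close>

lemma ex_monomial_order: "\<exists>r :: (('n::finite) mon \<times> 'n mon) set. monomial_order r"
proof -
  obtain h :: "'n \<Rightarrow> nat" where h: "inj h"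
    using finite_imp_inj_to_nat_seg[of "UNIV :: 'n set"] by auto
  define lt where "lt s t \<longleftrightarrow> (\<exists>i. expo s i < expo t i \<and> (\<forall>j. h j < h i \<longrightarrow> expo s j = expo t j))"
    for s t :: "'n mon"
  have total: "lt s t \<or> lt t s" if neq: "s \<noteq> t" for s t
  proof -
    have "\<exists>i. expo s i \<noteq> expo t i"
      using neq poly_mapping_eqI[of s t] by blast
    then obtain i where i: "expo s i \<noteq> expo t i" "\<And>j. expo s j \<noteq> expo t j \<Longrightarrow> h i \<le> h j"
      using ex_has_least_nat[of "\<lambda>i. expo s i \<noteq> expo t i" _ h] by blast
    then have "\<forall>j. h j < h i \<longrightarrow> expo s j = expo t j"
      by (metis not_le)
    with i(1) show ?thesis
      unfolding lt_def by (metis linorder_neqE_nat)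
  qed
  have trans: "lt s u" if "lt s t" "lt t u" for s t u
  proof -
    from that obtain i j where
      i: "expo s i < expo t i" "\<forall>k. h k < h i \<longrightarrow> expo s k = expo t k" and
      j: "expo t j < expo u j" "\<forall>k. h k < h j \<longrightarrow> expo t k = expo u k"
      unfolding lt_def by blast
    consider "h i < h j" | "i = j" | "h j < h i"
      using h by (metis injD linorder_neqE_nat)
    then show ?thesis
    proof cases
      case 1
      then show ?thesis
        unfolding lt_def using i j by (intro exI[of _ i]) auto
    next
      case 2
      then show ?thesis
        unfolding lt_def using i j by (intro exI[of _ i]) auto
    next
      case 3
      then show ?thesis
        unfolding lt_def using i j by (intro exI[of _ j]) auto
    qed
  qed
  have irrefl: "\<not> lt s s" for s
    by (simp add: lt_def)
  have zero: "s = 0 \<or> lt 0 s" for s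
    using total[of 0 s] by (auto simp: lt_def)
  have add: "lt (s + u) (t + u)" if "lt s t" for s t u
    using that by (simp add: lt_def lookup_add)
  have "monomial_order {(s, t). s = t \<or> lt s t}"
    unfolding monomial_order_def order_on_defs
  proof (intro conjI)
    show "{(s, t). s = t \<or> lt s t} \<subseteq> UNIV \<times> UNIV" by simp
    show "refl {(s, t). s = t \<or> lt s t}" by (simp add: refl_on_def)
    show "trans {(s, t). s = t \<or> lt s t}" by (rule transI) (auto dest: trans)
    show "antisym {(s, t). s = t \<or> lt s t}" by (rule antisymI) (auto dest: trans simp: irrefl)
    show "total {(s, t). s = t \<or> lt s t}" using total by (auto simp: total_on_def)
    show "\<forall>t. (0, t) \<in> {(s, t). s = t \<or> lt s t}" using zero by auto
    show "\<forall>s t u. (s, t) \<in> {(s, t). s = t \<or> lt s t} \<longrightarrow> (s + u, t + u) \<in> {(s, t). s = t \<or> lt s t}"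
      using add by auto
  qed
  then show ?thesis by blast
qed

text \<open>Weighted degrees are compared first and ties are broken by an arbitrary monomial order,
  so zero weights are allowed too.\<close>

lemma ex_weighted_order:
  fixes w :: "'n::finite \<Rightarrow> nat"
  shows "\<exists>r. monomial_order r \<and> (\<forall>s t. (s, t) \<in> r \<longrightarrow> wdeg w s \<le> wdeg w t)"
proof -
  obtain r0 :: "('n mon \<times> 'n mon) set" where r0: "monomial_order r0"
    using ex_monomial_order by blast
  let ?r = "{(s, t). wdeg w s < wdeg w t \<or> wdeg w s = wdeg w t \<and> (s, t) \<in> r0}"
  have "monomial_order ?r"
    unfolding monomial_order_def order_on_defs
  proof (intro conjI)
    note r0 = r0[unfolded monomial_order_def order_on_defs]
    show "?r \<subseteq> UNIV \<times> UNIV" by simp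
    show "refl ?r" using r0 by (auto simp: refl_on_def)
    show "trans ?r" by (rule transI) (use r0 in \<open>auto dest: transD\<close>)
    show "antisym ?r" by (rule antisymI) (use r0 in \<open>auto dest: antisymD\<close>)
    show "total ?r" using r0 by (auto simp: total_on_def)
    show "\<forall>t. (0, t) \<in> ?r" using r0 by (auto intro: gr0I)
    show "\<forall>s t u. (s, t) \<in> ?r \<longrightarrow> (s + u, t + u) \<in> ?r"
      using r0 by (auto simp: wdeg_add)
  qed
  moreover have "\<forall>s t. (s, t) \<in> ?r \<longrightarrow> wdeg w s \<le> wdeg w t"
    by auto
  ultimately show ?thesis by blast
qed

section \<open>Orders that realise the squares and the minimal codewords\<close>

context code_order
begin

text \<open>A monomial below \<open>bit_exp a\<close> avoids the heavy variables outside \<open>supp u\<close>, so by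
  minimality its parity vector is \<open>a\<close> or \<open>a + u\<close>.\<close>

lemma not_nonstd_bit_exp:
  assumes w: "\<And>s t. (s, t) \<in> r \<Longrightarrow> wdeg w s \<le> wdeg w t"
    and u: "minimal_word C u" and a: "supp a \<subseteq> supp u"
    and less: "wdeg w (bit_exp a) < wdeg w (bit_exp (a + u))"
    and outside: "\<And>i. i \<notin> supp u \<Longrightarrow> wdeg w (bit_exp a) < w i"
  shows "\<not> nonstd (bit_exp a)"
proof
  assume "nonstd (bit_exp a)"
  then obtain m where m: "(m, bit_exp a) \<in> r" "m \<noteq> bit_exp a" "code_equiv C m (bit_exp a)"
    unfolding nonstd_def by blast
  have le: "wdeg w m \<le> wdeg w (bit_exp a)"
    by (rule w[OF m(1)])
  have "parity m $ i = 0" if "i \<notin> supp u" for i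
  proof -
    have "w i * expo m i < w i"
      using wdeg_ge[of w i m] le outside[OF that] by linarith
    then have "expo m i = 0"
      by simp
    then show ?thesis
      by (simp add: parity_def)
  qed
  then have "supp (parity m) \<subseteq> supp u"
    unfolding supp_def by blast
  then have "supp (parity m + a) \<subseteq> supp u"
    using a by (auto simp: supp_add)
  moreover have "parity m + a \<in> C"
    using m(3) by (simp add: code_equiv_def bit_vec_diff)
  ultimately have "parity m + a = 0 \<or> parity m + a = u"
    using u unfolding minimal_word_def by blast
  \<comment> \<open>Adding \<open>a\<close> twice cancels in characteristic two.\<close>
  moreover have "parity m = a + (parity m + a)"
    by (simp add: add.left_commute[of a])
  ultimately have "parity m = a \<or> parity m = a + u"
    by (metis add.right_neutral)
  then show False
  proof
    \<comment> \<open>Here \<open>bit_exp a\<close> divides \<open>m\<close> and thus lies below it;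
      in the other case \<open>bit_exp (a + u)\<close> divides \<open>m\<close>, which makes
      \<open>m\<close> too heavy.\<close>
    assume "parity m = a"
    then have "(bit_exp a, m) \<in> r"
      using ord_dvd[OF bit_exp_parity_dvd] by metis
    then show False
      using m ord_antisym by blast
  next
    assume "parity m = a + u"
    then have "wdeg w (bit_exp (a + u)) \<le> wdeg w m"
      using wdeg_mono[OF bit_exp_parity_dvd] by metis
    then show False
      using le less by linarith
  qed
qed

text \<open>Only \<open>1\<close> and \<open>x_i\<close> have weight at most one. They are
  inequivalent because the unit vector is not in \<open>C\<close>, so both proper divisors of
  \<open>x_i^2\<close> are standard.\<close>

lemma min_nonstd_square:
  assumes w: "\<And>s t. (s, t) \<in> r \<Longrightarrow> wdeg (\<lambda>j. if j = i then 1 else 2) s \<le> wdeg (\<lambda>j. if j = i then 1 else 2) t"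
    and "axis i 1 \<notin> C"
  shows "min_nonstd (Poly_Mapping.single i 2)"
proof -
  let ?w = "\<lambda>j. if j = i then 1 else (2 :: nat)"
  let ?x = "bit_exp (axis i 1) :: 'n mon"
  have "\<not> nonstd ?x"
  proof
    assume "nonstd ?x"
    then obtain m where m: "(m, ?x) \<in> r" "m \<noteq> ?x" "code_equiv C m ?x"
      unfolding nonstd_def by blast
    have le: "wdeg ?w m \<le> 1"
      using w[OF m(1)] by (simp add: wdeg_bit_exp supp_axis)
    have out: "expo m j = 0" if "j \<noteq> i" for j
      using wdeg_ge[of ?w j m] le that by simp
    have "m = Poly_Mapping.single i (expo m i)"
      by (rule poly_mapping_eqI) (use out in \<open>auto simp: lookup_single when_def\<close>)
    moreover have "expo m i = 0 \<or> expo m i = 1"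
      using wdeg_ge[of ?w i m] le by auto
    ultimately have "m = 0 \<or> m = ?x"
      unfolding bit_exp_axis by (metis single_zero)
    then show False
      using m assms(2) equiv_sym[OF m(3)] by (auto simp: code_equiv_def)
  qed
  then have "s = Poly_Mapping.single i 2"
    if s: "mon_dvd s (Poly_Mapping.single i 2)" "nonstd s" for s
  proof -
    have le: "expo s j \<le> (if i = j then 2 else 0)" for j
      using s(1) by (simp add: mon_dvd_iff lookup_single when_def)
    have "expo s j = 0" if "i \<noteq> j" for j
      using le[of j] that by simp
    then have "s = Poly_Mapping.single i (expo s i)"
      by (intro poly_mapping_eqI) (auto simp: lookup_single when_def)
    moreover have "expo s i = 0 \<or> expo s i = 1 \<or> expo s i = 2"
      using le[of i] by auto
    ultimately have "s = 0 \<or> s = ?x \<or> s = Poly_Mapping.single i 2"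
      unfolding bit_exp_axis by (metis single_zero)
    then show ?thesis
      using s(2) \<open>\<not> nonstd ?x\<close> not_nonstd_zero by metis
  qed
  with nonstd_square show ?thesis
    unfolding min_nonstd_def by blast
qed

end

text \<open>With \<open>n = card (supp c)\<close> and \<open>m = card (supp c')\<close>, the weights \<open>n m + 1\<close> on \<open>supp c\<close> and
  \<open>n\<^sup>2\<close> on \<open>supp c'\<close> make \<open>c\<close> slightly heavier than \<open>c'\<close>, but moving a single variable from \<open>c\<close>
  to \<open>c'\<close> already reverses the comparison.\<close>

lemma ex_order_minimal_word:
  fixes c c' :: "bit^'n"
  assumes C: "vec.subspace C" and c: "c \<noteq> 0" "c' \<noteq> 0" "supp c \<inter> supp c' = {}"
    and min: "minimal_word C (c - c')"
  shows "\<exists>r. monomial_order r \<and> code_order.min_nonstd C r (bit_exp c) \<and> \<not> code_order.nonstd C r (bit_exp c')"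
proof -
  let ?u = "c - c'"
  define n m where "n = card (supp c)" and "m = card (supp c')"
  \<comment> \<open>A variable outside the support of \<open>?u\<close> weighs one more than
    \<open>bit_exp c\<close>, as \<open>not_nonstd_bit_exp\<close> requires.\<close>
  define w where "w i = (if i \<in> supp c then n * m + 1 else if i \<in> supp c' then n * n
    else n * (n * m + 1) + 1)" for i
  have nm: "n > 0" "m > 0"
    using c by (auto simp: n_def m_def card_gt_0_iff)
  obtain r where r: "monomial_order r" and wr: "\<And>s t. (s, t) \<in> r \<Longrightarrow> wdeg w s \<le> wdeg w t"
    using ex_weighted_order[of w] by blast
  interpret code_order C r
    by unfold_locales (fact C r)+
  have supp_u: "supp ?u = supp c \<union> supp c'"
    using c(3) by (simp add: bit_vec_diff supp_add)
  have w_sub: "wdeg w (bit_exp a) = card (supp a) * (n * m + 1)" if "supp a \<subseteq> supp c" for a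
  proof -
    have "wdeg w (bit_exp a) = (\<Sum>i\<in>supp a. n * m + 1)"
      unfolding wdeg_bit_exp by (rule sum.cong) (use that in \<open>auto simp: w_def\<close>)
    then show ?thesis by simp
  qed
  have w_c: "wdeg w (bit_exp c) = n * (n * m + 1)"
    using w_sub[of c] by (simp add: n_def)
  have "wdeg w (bit_exp c') = (\<Sum>i\<in>supp c'. n * n)"
    unfolding wdeg_bit_exp by (rule sum.cong) (use c(3) in \<open>auto simp: w_def\<close>)
  then have w_c': "wdeg w (bit_exp c') = m * (n * n)"
    by (simp add: m_def)
  \<comment> \<open>The two weights differ by exactly \<open>n\<close>.\<close>
  have less: "wdeg w (bit_exp c') < wdeg w (bit_exp c)"
    using nm by (simp add: w_c w_c' algebra_simps)
  have out: "w i = n * (n * m + 1) + 1" if "i \<notin> supp ?u" for i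
    using that by (simp add: supp_u w_def)
  have std': "\<not> nonstd (bit_exp c')"
  proof (rule not_nonstd_bit_exp[OF wr min])
    have "c' + ?u = c" by simp
    then show "wdeg w (bit_exp c') < wdeg w (bit_exp (c' + ?u))"
      using less by simp
  qed (use less out w_c in \<open>auto simp: supp_u\<close>)
  \<comment> \<open>A proper part \<open>a\<close> of \<open>c\<close> competes with
    \<open>a + ?u\<close>, which is the complementary part of \<open>c\<close> together with
    \<open>c'\<close>.\<close>
  have std: "\<not> nonstd (bit_exp a)" if a: "supp a \<subset> supp c" for a
  proof (rule not_nonstd_bit_exp[OF wr min])
    have card: "card (supp a) < n"
      unfolding n_def by (rule psubset_card_mono[OF _ a]) simp
    have ac: "supp (a + c) = supp c - supp a"
      using a by (auto simp: supp_add)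
    then have "supp (a + c) \<inter> supp c' = {}"
      using c(3) by blast
    then have "bit_exp (a + ?u) = bit_exp (a + c) + bit_exp c'"
      using bit_exp_add[of "a + c" c'] by (simp add: bit_vec_diff add.assoc)
    moreover have "wdeg w (bit_exp (a + c)) = (n - card (supp a)) * (n * m + 1)"
      using w_sub[of "a + c"] ac a by (simp add: n_def card_Diff_subset psubset_imp_subset)
    ultimately have 1: "wdeg w (bit_exp (a + ?u)) = (n - card (supp a)) * (n * m + 1) + m * (n * n)"
      by (simp add: wdeg_add w_c')
    have 2: "wdeg w (bit_exp a) = card (supp a) * (n * m + 1)"
      using w_sub a by blast
    \<comment> \<open>Both sides are bounded by the extreme case
      \<open>card (supp a) = n - 1\<close>, which leaves one inequality in \<open>n\<close> and
      \<open>m\<close>.\<close>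
    have "card (supp a) * (n * m + 1) \<le> (n - 1) * (n * m + 1)"
      using card by (intro mult_right_mono) auto
    moreover have "(n * m + 1) \<le> (n - card (supp a)) * (n * m + 1)"
      using card by (cases "n - card (supp a)") auto
    moreover have "(n - 1) * (n * m + 1) < (n * m + 1) + m * (n * n)"
    proof -
      obtain k where k: "n = Suc k" using nm by (cases n) auto
      have "k \<le> n * m" using nm k by (metis le_SucI less_eq_Suc_le mult.right_neutral mult_le_mono2 order.trans le_refl One_nat_def)
      then show ?thesis by (simp add: k algebra_simps)
    qed
    ultimately show "wdeg w (bit_exp a) < wdeg w (bit_exp (a + ?u))"
      unfolding 1 2 by linarith
    have "card (supp a) * (n * m + 1) \<le> n * (n * m + 1)"
      using card by (intro mult_right_mono) auto
    then show "wdeg w (bit_exp a) < w i" if "i \<notin> supp ?u" for i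
      unfolding out[OF that] 2 by linarith
    show "supp a \<subseteq> supp ?u"
      using a by (auto simp: supp_u)
  qed
  have "min_nonstd (bit_exp c)"
    unfolding min_nonstd_def
  proof (intro conjI allI impI)
    have "(bit_exp c', bit_exp c) \<in> r"
      using less wr ord_total by (metis not_le)
    moreover have "code_equiv C (bit_exp c') (bit_exp c)"
      using min vec.subspace_neg[OF C, of ?u] by (simp add: code_equiv_def minimal_word_def)
    moreover have "bit_exp c' \<noteq> bit_exp c"
      using less by auto
    ultimately show "nonstd (bit_exp c)"
      unfolding nonstd_def by blast
  next
    fix s
    assume s: "mon_dvd s (bit_exp c)" "nonstd s"
    \<comment> \<open>Divisors of a square-free monomial correspond to subsets of its support, and
      \<open>std\<close> covers the proper subsets.\<close>
    have "expo s i \<le> 1" for i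
      using s(1)[unfolded mon_dvd_iff, rule_format, of i] by (auto split: if_splits)
    then have s': "bit_exp (parity s) = s"
      by (rule bit_exp_parity)
    then have "supp (parity s) \<subseteq> supp c"
      using s(1) by (metis mon_dvd_bit_exp_iff)
    then have "supp (parity s) = supp c"
      using std s(2) s' by (metis psubsetI)
    then show "s = bit_exp c"
      using s' by simp
  qed
  with r std' show ?thesis by blast
qed

section \<open>Description of the universal Groebner basis\<close>

theorem theorem8:
  fixes C :: "(bit^'n) set" and G :: "bit^'n^'k"
  assumes "binary_code CARD('k) C"
    and "generator_matrix G C"
    and no_zero_column: "\<forall>j. column j G \<noteq> 0"
    and no_weight_one: "\<forall>u \<in> C. wt u \<noteq> 1"
  shows "universal_groebner_basis (code_ideal C :: ('n, 'a::field) mpoly set) =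
    {xpow c - xpow c' | c c'.
       c \<noteq> 0 \<and> c' \<noteq> 0 \<and> supp c \<inter> supp c' = {} \<and>
       c - c' \<in> C \<and>
       wt (c - c') \<le> CARD('n) - CARD('k) + 1 \<and>
       rank (col_submatrix G (UNIV - supp (c - c'))) = CARD('k) - 1}
    \<union> {var i ^ 2 - 1 | i. True}"
    (is "_ = ?words \<union> ?squares")
proof -
  have C: "vec.subspace C"
    using assms(1) by (simp add: binary_code_def)
  note rank_iff = rank_eq_iff_minimal_word[OF assms(1,2)]
  note wt_le = wt_minimal_word[OF assms(1,2)]
  have sq: "var i ^ 2 - 1 = (mono_poly (Poly_Mapping.single i 2) - mono_poly 0 :: ('n, 'a) mpoly)" for i
    by (rule square_binomial)
  show ?thesis
    unfolding universal_groebner_basis_code_ideal[OF C]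
  proof (intro equalityI subsetI; (elim UnE)?)
    fix g :: "('n, 'a) mpoly"
    assume "g \<in> {mono_poly t - mono_poly s | r t s. monomial_order r \<and> code_order.min_nonstd C r t \<and>
       \<not> code_order.nonstd C r s \<and> code_equiv C s t}"
    then obtain r t s where r: "monomial_order r" and g: "g = mono_poly t - mono_poly s"
      and ts: "code_order.min_nonstd C r t" "\<not> code_order.nonstd C r s" "code_equiv C s t"
      by blast
    interpret code_order C r
      by unfold_locales (fact C r)+
    show "g \<in> ?words \<union> ?squares"
    proof (cases rule: min_nonstd_binomial_cases[OF no_weight_one ts, consumes 0, case_names square word])
      case (square i)
      then have "g \<in> ?squares"
        unfolding sq g by blast
      then show ?thesis ..
    next
      case (word c c')
      then have u: "c - c' \<in> C" "c - c' \<noteq> 0"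
        by (auto simp: minimal_word_def)
      have "g \<in> ?words"
        using word u rank_iff[OF u] wt_le[OF u] unfolding g xpow_def by blast
      then show ?thesis ..
    qed
  next
    fix g
    assume "g \<in> ?words"
    then obtain c c' where g: "g = xpow c - xpow c'" and c: "c \<noteq> 0" "c' \<noteq> 0" "supp c \<inter> supp c' = {}"
      and u: "c - c' \<in> C" and rank: "rank (col_submatrix G (UNIV - supp (c - c'))) = CARD('k) - 1"
      by blast
    have "c - c' \<noteq> 0"
      using c by auto
    with u rank have "minimal_word C (c - c')"
      using rank_iff by blast
    then obtain r where "monomial_order r" "code_order.min_nonstd C r (bit_exp c)"
      "\<not> code_order.nonstd C r (bit_exp c')"
      using ex_order_minimal_word[OF C c] by blast
    moreover have "code_equiv C (bit_exp c') (bit_exp c)"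
      using vec.subspace_neg[OF C u] by (simp add: code_equiv_def)
    ultimately show "g \<in> {mono_poly t - mono_poly s | r t s. monomial_order r \<and> code_order.min_nonstd C r t \<and>
       \<not> code_order.nonstd C r s \<and> code_equiv C s t}"
      unfolding g xpow_def by blast
  next
    fix g :: "('n, 'a) mpoly"
    assume "g \<in> ?squares"
    then obtain i where g: "g = mono_poly (Poly_Mapping.single i 2) - mono_poly 0"
      unfolding sq by blast
    \<comment> \<open>The variable \<open>x_i\<close> is made the lightest, so that
      \<open>min_nonstd_square\<close> applies.\<close>
    obtain r :: "('n mon \<times> 'n mon) set" where r: "monomial_order r"
      and w: "\<And>s t. (s, t) \<in> r \<Longrightarrow> wdeg (\<lambda>j. if j = i then 1 else 2) s \<le> wdeg (\<lambda>j. if j = i then 1 else 2) t"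
      using ex_weighted_order by blast
    interpret code_order C r
      by unfold_locales (fact C r)+
    \<comment> \<open>A unit vector has weight one.\<close>
    have "axis i 1 \<notin> C"
      using no_weight_one supp_axis[of i] by (auto simp: wt_def)
    then have "min_nonstd (Poly_Mapping.single i 2)"
      by (rule min_nonstd_square[rotated]) (rule w)
    moreover have "code_equiv C 0 (Poly_Mapping.single i 2)"
      using vec.subspace_0[OF C] by (simp add: code_equiv_def)
    ultimately show "g \<in> {mono_poly t - mono_poly s | r t s. monomial_order r \<and> code_order.min_nonstd C r t \<and>
       \<not> code_order.nonstd C r s \<and> code_equiv C s t}"
      using r not_nonstd_zero unfolding g by blast
  qed
qed

end
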